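(* Let $n \geq 5$ and $m \geq 1$. Suppose that there is $d\in\{n,n-1\}$ such that neither $m$ nor $m-1$ is divisible by $d$. Then every special homomorphism $B_n \to B_m$ has cyclic image.
   Context: $B_n$ is the braid group on $n$ strands. A braid in $B_n$ is periodic if some positive power of it lies in the center of $B_n$. A homomorphism $B_n\to B_m$ is special if it sends periodic elements to periodic elements. *)

theory Defs
  imports "HOL-Algebra.Elementary_Groups"
begin

text \<open>
  The braid group on \<open>n\<close> strands, given by Artin's presentation with generators
  \<open>\<sigma>\<^sub>1, \<dots>, \<sigma>\<^sub>n\<^sub>-\<^sub>1\<close>. A letter \<open>(i, True)\<close> stands for \<open>\<sigma>\<^sub>i\<close> and \<open>(i, False)\<close> for its inverse.
  For \<open>n \<le> 1\<close> there are no generators and the group is trivial.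
\<close>

type_synonym braid_word = "(nat \<times> bool) list"

definition braid_words :: "nat \<Rightarrow> braid_word set" where
  "braid_words n = lists ({1..<n} \<times> UNIV)"

inductive_set braid_cong :: "nat \<Rightarrow> (braid_word \<times> braid_word) set" for n :: nat where
  refl: "u \<in> braid_words n \<Longrightarrow> (u, u) \<in> braid_cong n"
| sym: "(u, v) \<in> braid_cong n \<Longrightarrow> (v, u) \<in> braid_cong n"
| trans: "(u, v) \<in> braid_cong n \<Longrightarrow> (v, w) \<in> braid_cong n \<Longrightarrow> (u, w) \<in> braid_cong n"
| append: "(u, u') \<in> braid_cong n \<Longrightarrow> (v, v') \<in> braid_cong n \<Longrightarrow> (u @ v, u' @ v') \<in> braid_cong n"
| cancel: "1 \<le> i \<Longrightarrow> i < n \<Longrightarrow> ([(i, b), (i, \<not> b)], []) \<in> braid_cong n"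
| far: "1 \<le> i \<Longrightarrow> i + 2 \<le> j \<Longrightarrow> j < n \<Longrightarrow>
    ([(i, True), (j, True)], [(j, True), (i, True)]) \<in> braid_cong n"
| braid: "1 \<le> i \<Longrightarrow> i + 1 < n \<Longrightarrow>
    ([(i, True), (i + 1, True), (i, True)], [(i + 1, True), (i, True), (i + 1, True)])
      \<in> braid_cong n"

definition braid_group :: "nat \<Rightarrow> braid_word set monoid" where
  "braid_group n =
    \<lparr>carrier = braid_words n // braid_cong n,
     mult = (\<lambda>A B. \<Union>u\<in>A. \<Union>v\<in>B. braid_cong n `` {u @ v}),
     one = braid_cong n `` {[]}\<rparr>"

definition group_center :: "('a, 'b) monoid_scheme \<Rightarrow> 'a set" where
  "group_center G = {z \<in> carrier G. \<forall>x\<in>carrier G. z \<otimes>\<^bsub>G\<^esub> x = x \<otimes>\<^bsub>G\<^esub> z}"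

definition periodic_braid :: "nat \<Rightarrow> braid_word set \<Rightarrow> bool" where
  "periodic_braid n x \<longleftrightarrow> x \<in> carrier (braid_group n) \<and>
    (\<exists>k::nat. k > 0 \<and> x [^]\<^bsub>braid_group n\<^esub> k \<in> group_center (braid_group n))"

definition special_hom :: "nat \<Rightarrow> nat \<Rightarrow> (braid_word set \<Rightarrow> braid_word set) \<Rightarrow> bool" where
  "special_hom n m f \<longleftrightarrow> f \<in> hom (braid_group n) (braid_group m) \<and>
    (\<forall>x\<in>carrier (braid_group n). periodic_braid n x \<longrightarrow> periodic_braid m (f x))"

lemma braid_cong_words: "(u, v) \<in> braid_cong n \<Longrightarrow> u \<in> braid_words n \<and> v \<in> braid_words n"
  by (induction rule: braid_cong.induct) (auto simp: braid_words_def)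

lemma equiv_braid_cong: "equiv (braid_words n) (braid_cong n)"
  by (auto simp: equiv_def refl_on_def sym_def trans_def
      dest: braid_cong_words intro: braid_cong.intros)

lemma braid_class_in_carrier:
  "u \<in> braid_words n \<Longrightarrow> braid_cong n `` {u} \<in> carrier (braid_group n)"
  by (simp add: braid_group_def quotientI)

lemma braid_class_mult:
  assumes "u \<in> braid_words n" "v \<in> braid_words n"
  shows "braid_cong n `` {u} \<otimes>\<^bsub>braid_group n\<^esub> braid_cong n `` {v} = braid_cong n `` {u @ v}"
proof -
  have "(\<lambda>x y. braid_cong n `` {x @ y}) respects2 braid_cong n"
    by (rule congruent2I')
      (simp add: equiv_class_eq[OF equiv_braid_cong] braid_cong.append)
  from UN_equiv_class2[OF equiv_braid_cong equiv_braid_cong this assms]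
  show ?thesis by (simp add: braid_group_def)
qed

lemma braid_word_left_inverse:
  "u \<in> braid_words n \<Longrightarrow> \<exists>v\<in>braid_words n. (v @ u, []) \<in> braid_cong n"
proof (induction u)
  case Nil
  then show ?case by (auto intro: bexI[of _ "[]"] braid_cong.refl)
next
  case (Cons a u)
  obtain i b where a: "a = (i, b)" by force
  from Cons have i: "1 \<le> i" "i < n" and u: "u \<in> braid_words n"
    by (auto simp: a braid_words_def)
  from Cons.IH[OF u] obtain v where v: "v \<in> braid_words n" "(v @ u, []) \<in> braid_cong n"
    by blast
  have "([(i, \<not> b), (i, b)], []) \<in> braid_cong n"
    using braid_cong.cancel[OF i, of "\<not> b"] by simp
  from braid_cong.append[OF braid_cong.refl[OF v(1)]
      braid_cong.append[OF this braid_cong.refl[OF u]]]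
  have "(v @ [(i, \<not> b), (i, b)] @ u, v @ u) \<in> braid_cong n" by simp
  from braid_cong.trans[OF this v(2)]
  have "((v @ [(i, \<not> b)]) @ a # u, []) \<in> braid_cong n" by (simp add: a)
  moreover have "v @ [(i, \<not> b)] \<in> braid_words n"
    using v(1) i by (auto simp: braid_words_def)
  ultimately show ?case by blast
qed

lemma group_braid_group: "group (braid_group n)"
proof -
  have nil: "[] \<in> braid_words n" by (simp add: braid_words_def)
  have app: "u @ v \<in> braid_words n" if "u \<in> braid_words n" "v \<in> braid_words n" for u v
    using that by (auto simp: braid_words_def)
  have one: "\<one>\<^bsub>braid_group n\<^esub> = braid_cong n `` {[]}"
    by (simp add: braid_group_def)
  have rep: "\<exists>u\<in>braid_words n. x = braid_cong n `` {u}" if "x \<in> carrier (braid_group n)" for x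
    using that by (auto simp: braid_group_def elim: quotientE)
  show ?thesis
  proof (rule groupI)
    show "\<one>\<^bsub>braid_group n\<^esub> \<in> carrier (braid_group n)"
      by (simp add: one braid_class_in_carrier nil)
  next
    fix x y assume "x \<in> carrier (braid_group n)" "y \<in> carrier (braid_group n)"
    then show "x \<otimes>\<^bsub>braid_group n\<^esub> y \<in> carrier (braid_group n)"
      by (auto dest!: rep simp: braid_class_mult app braid_class_in_carrier)
  next
    fix x y z
    assume "x \<in> carrier (braid_group n)" "y \<in> carrier (braid_group n)" "z \<in> carrier (braid_group n)"
    then show "x \<otimes>\<^bsub>braid_group n\<^esub> y \<otimes>\<^bsub>braid_group n\<^esub> z
        = x \<otimes>\<^bsub>braid_group n\<^esub> (y \<otimes>\<^bsub>braid_group n\<^esub> z)"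
      by (auto dest!: rep simp: braid_class_mult app)
  next
    fix x assume "x \<in> carrier (braid_group n)"
    then show "\<one>\<^bsub>braid_group n\<^esub> \<otimes>\<^bsub>braid_group n\<^esub> x = x"
      by (auto dest!: rep simp: one braid_class_mult nil)
  next
    fix x assume "x \<in> carrier (braid_group n)"
    then obtain u where u: "u \<in> braid_words n" "x = braid_cong n `` {u}" using rep by blast
    from braid_word_left_inverse[OF u(1)]
    obtain v where v: "v \<in> braid_words n" "(v @ u, []) \<in> braid_cong n" by blast
    have "braid_cong n `` {v} \<otimes>\<^bsub>braid_group n\<^esub> x = \<one>\<^bsub>braid_group n\<^esub>"
      using u v by (simp add: one braid_class_mult equiv_class_eq[OF equiv_braid_cong])
    then show "\<exists>y\<in>carrier (braid_group n). y \<otimes>\<^bsub>braid_group n\<^esub> x = \<one>\<^bsub>braid_group n\<^esub>"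
      using braid_class_in_carrier[OF v(1)] by blast
  qed
qed

end

theory Submission
  imports Defs "HOL-Combinatorics.Permutations"
begin

text \<open>
  Write \<open>\<alpha> = \<sigma>\<^sub>1 \<cdots> \<sigma>\<^sub>n\<^sub>-\<^sub>1\<close> and \<open>\<beta> = \<sigma>\<^sub>1 \<alpha>\<close>, so that \<open>\<alpha>\<^sup>n = \<beta>\<^sup>n\<^sup>-\<^sup>1\<close> is the full twist, which is
  central. Conjugation by powers of \<open>\<alpha>\<close> and \<open>\<beta>\<close> shifts the generators; hence if \<open>f(\<alpha>\<^sup>j)\<close> is central for
  some \<open>j\<close> not divisible by \<open>n\<close>, or \<open>f(\<beta>\<^sup>j)\<close> for some \<open>j\<close> not divisible by \<open>n - 1\<close>, two generators
  that both commute and satisfy the braid relation are identified in the image, and then all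
  generators are. It therefore suffices that \<open>x\<^sup>m\<close> or \<open>x\<^sup>m\<^sup>-\<^sup>1\<close> is central for every periodic
  \<open>x\<close> in the braid group on \<open>m\<close> strands.

  For this no classification of periodic braids is needed. Garside's theory of positive
  braids makes the group a left-invariant lattice. Consequently it is torsion-free, and a central
  element of exponent sum 0 is trivial, so \<open>x\<^sup>k = T\<^sup>e\<close> for some \<open>k > 0\<close>, with \<open>T\<close> the full twist.
  Summing winding numbers of pairs of strands gives \<open>k dvd m e\<close> if the permutation of \<open>x\<close> has no
  fixed point and \<open>k dvd (m - 1) e\<close> if it has one. If \<open>k s = j e\<close> with \<open>j\<close> one of \<open>m\<close>, \<open>m - 1\<close>, then
  \<open>x\<^sup>j T\<^sup>-\<^sup>s\<close> is torsion, so \<open>x\<^sup>j = T\<^sup>s\<close>.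
\<close>

section \<open>Positive braid words and Garside's lemma\<close>

text \<open>Together with \<open>adj\<close> this symmetrizes the index conditions in Artin's
  relations: distinct indices are either adjacent or far, so case distinctions need no
  ordering.\<close>

definition far :: "nat \<Rightarrow> nat \<Rightarrow> bool" where
  "far i j \<longleftrightarrow> i + 2 \<le> j \<or> j + 2 \<le> i"

definition adj :: "nat \<Rightarrow> nat \<Rightarrow> bool" where
  "adj i j \<longleftrightarrow> j = Suc i \<or> i = Suc j"

lemma far_sym: "far i j \<Longrightarrow> far j i"
  by (auto simp: far_def)

lemma adj_sym: "adj i j \<Longrightarrow> adj j i"
  by (auto simp: adj_def)

lemma index_cases: "i = j \<or> adj i j \<or> far i j"
  by (auto simp: far_def adj_def)

inductive pos_step :: "nat list \<Rightarrow> nat list \<Rightarrow> bool" where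
  far: "far i j \<Longrightarrow> pos_step (i # j # v) (j # i # v)"
| adj: "adj i j \<Longrightarrow> pos_step (i # j # i # v) (j # i # j # v)"
| Cons: "pos_step u v \<Longrightarrow> pos_step (a # u) (a # v)"

text \<open>Equality in the positive braid monoid. Both relations can be read in either direction,
  so chains of steps already form an equivalence.\<close>

definition pos_cong :: "nat list \<Rightarrow> nat list \<Rightarrow> bool" (infix \<open>\<approx>\<close> 50) where
  "u \<approx> v \<longleftrightarrow> pos_step\<^sup>*\<^sup>* u v"

lemma pos_step_sym: "pos_step u v \<Longrightarrow> pos_step v u"
  by (induction rule: pos_step.induct) (auto intro: pos_step.intros dest: far_sym adj_sym)

lemma pos_cong_refl [simp, intro]: "u \<approx> u"
  by (simp add: pos_cong_def)

lemma pos_cong_trans [trans]: "u \<approx> v \<Longrightarrow> v \<approx> w \<Longrightarrow> u \<approx> w"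
  by (auto simp: pos_cong_def)

lemma pos_cong_sym: "u \<approx> v \<Longrightarrow> v \<approx> u"
  unfolding pos_cong_def
  by (induction rule: rtranclp_induct) (auto intro: converse_rtranclp_into_rtranclp pos_step_sym)

lemma pos_cong_Cons: "u \<approx> v \<Longrightarrow> a # u \<approx> a # v"
  unfolding pos_cong_def
  by (induction rule: rtranclp_induct) (auto intro: rtranclp.rtrancl_into_rtrancl pos_step.Cons)

lemma pos_cong_far: "far i j \<Longrightarrow> i # j # v \<approx> j # i # v"
  by (auto simp: pos_cong_def intro: pos_step.far)

lemma pos_cong_adj: "adj i j \<Longrightarrow> i # j # i # v \<approx> j # i # j # v"
  by (auto simp: pos_cong_def intro: pos_step.adj)

lemma pos_step_append_right: "pos_step u v \<Longrightarrow> pos_step (u @ w) (v @ w)"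
  by (induction rule: pos_step.induct) (auto intro: pos_step.intros)

lemma pos_cong_append_left: "u \<approx> v \<Longrightarrow> w @ u \<approx> w @ v"
  by (induction w) (auto intro: pos_cong_Cons)

lemma pos_cong_append_right: "u \<approx> v \<Longrightarrow> u @ w \<approx> v @ w"
  unfolding pos_cong_def
  by (induction rule: rtranclp_induct)
    (auto intro: rtranclp.rtrancl_into_rtrancl pos_step_append_right)

lemma pos_cong_append: "u \<approx> u' \<Longrightarrow> v \<approx> v' \<Longrightarrow> u @ v \<approx> u' @ v'"
  by (meson pos_cong_append_left pos_cong_append_right pos_cong_trans)

text \<open>The relations preserve the number of letters, on which the inductions below run, and the
  set of letters, which keeps words inside the generators of a given braid group.\<close>

lemma pos_cong_length_set:
  assumes "u \<approx> v"
  shows "length u = length v \<and> set u = set v"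
proof -
  have step: "length u = length v \<and> set u = set v" if "pos_step u v" for u v
    using that by (induction rule: pos_step.induct) auto
  have "pos_step\<^sup>*\<^sup>* u v" using assms by (simp add: pos_cong_def)
  then show ?thesis by (induction rule: rtranclp_induct) (simp_all add: step)
qed

text \<open>The word completing the letter \<open>i\<close> to the least common multiple of \<open>i\<close> and \<open>j\<close>.\<close>

definition complement :: "nat \<Rightarrow> nat \<Rightarrow> nat list" where
  "complement i j = (if i = j then [] else if adj i j then [j, i] else [j])"

lemma complement_simps [simp]:
  "complement i i = []"
  "adj i j \<Longrightarrow> complement i j = [j, i]"
  "far i j \<Longrightarrow> complement i j = [j]"
  by (auto simp: complement_def adj_def far_def)

text \<open>Says that \<open>i # X\<close> and \<open>j # Y\<close> arise from the least common
  multiple of \<open>i\<close> and \<open>j\<close> by the same positive factor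
  \<open>Z\<close>.\<close>

definition compat :: "nat \<Rightarrow> nat list \<Rightarrow> nat \<Rightarrow> nat list \<Rightarrow> bool" where
  "compat i X j Y \<longleftrightarrow> (\<exists>Z. X \<approx> complement i j @ Z \<and> Y \<approx> complement j i @ Z)"

lemma compatI: "X \<approx> complement i j @ Z \<Longrightarrow> Y \<approx> complement j i @ Z \<Longrightarrow> compat i X j Y"
  by (auto simp: compat_def)

lemma compat_sym: "compat i X j Y \<Longrightarrow> compat j Y i X"
  by (auto simp: compat_def)

lemma compat_same: "compat i X i Y \<longleftrightarrow> X \<approx> Y"
  by (auto simp: compat_def intro: pos_cong_sym pos_cong_trans)

lemma compat_cong:
  "compat i X j Y \<Longrightarrow> X' \<approx> X \<Longrightarrow> compat i X' j Y"
  by (auto simp: compat_def intro: pos_cong_trans)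

lemma compat_far:
  assumes "far i j" "compat i X j Y"
  obtains Z where "X \<approx> j # Z" "Y \<approx> i # Z"
  using assms far_sym[of i j] by (auto simp: compat_def)

lemma compat_adj:
  assumes "adj i j" "compat i X j Y"
  obtains Z where "X \<approx> j # i # Z" "Y \<approx> i # j # Z"
  using assms adj_sym[of i j] by (auto simp: compat_def)

lemma compat_farI:
  "far i j \<Longrightarrow> X \<approx> j # Z \<Longrightarrow> Y \<approx> i # Z \<Longrightarrow> compat i X j Y"
  by (auto intro: compatI[where Z=Z] simp: far_sym)

lemma compat_adjI:
  "adj i j \<Longrightarrow> X \<approx> j # i # Z \<Longrightarrow> Y \<approx> i # j # Z \<Longrightarrow> compat i X j Y"
  by (auto intro: compatI[where Z=Z] simp: adj_sym)

text \<open>Garside's lemma says that \<open>i # X \<approx> j # Y\<close> implies \<open>compat i X j Y\<close>. A single step always yields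
  compatible words; to chain steps, compatibility must be transitive, which uses the lemma itself
  for shorter words.\<close>

context
  fixes N :: nat
  assumes IH: "\<And>i X j Y. length X < N \<Longrightarrow> i # X \<approx> j # Y \<Longrightarrow> compat i X j Y"
begin

lemma IH_cancel: "length X < N \<Longrightarrow> i # X \<approx> i # Y \<Longrightarrow> X \<approx> Y"
  using IH compat_same by blast

text \<open>The middle word \<open>W\<close> starts, up to congruence, with \<open>i\<close> and
  also with \<open>j\<close>. The induction hypothesis for the shorter tails gives their common
  factor \<open>V\<close>, and \<open>k\<close> commutes past both letters.\<close>

lemma compat_trans_far_far:
  assumes N: "length W = N" and ik: "far i k" and kj: "far k j"
    and c: "compat i X k W" "compat k W j Y"
  shows "compat i X j Y"
proof -
  obtain Z where Z: "X \<approx> k # Z" "W \<approx> i # Z" using compat_far[OF ik c(1)] .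
  obtain Z' where Z': "W \<approx> j # Z'" "Y \<approx> k # Z'" using compat_far[OF kj c(2)] .
  have eq: "i # Z \<approx> j # Z'" using Z(2) Z'(1) pos_cong_sym pos_cong_trans by blast
  have len: "length Z < N" using pos_cong_length_set[OF Z(2)] N by auto
  consider "i = j" | "adj i j" | "far i j" using index_cases by blast
  then show ?thesis
  proof cases
    case 1
    then have "Z \<approx> Z'" using IH_cancel[OF len] eq by blast
    then have "X \<approx> Y" using Z(1) Z'(2) by (meson pos_cong_Cons pos_cong_sym pos_cong_trans)
    then show ?thesis using 1 by (simp add: compat_same)
  next
    case 2
    obtain V where V: "Z \<approx> j # i # V" "Z' \<approx> i # j # V" using compat_adj[OF 2 IH[OF len eq]] .
    show ?thesis
    proof (rule compat_adjI[OF 2])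
      note Z(1)
      also have "k # Z \<approx> k # j # i # V" by (intro pos_cong_Cons V)
      also have "\<dots> \<approx> j # k # i # V" by (intro pos_cong_far kj)
      also have "\<dots> \<approx> j # i # k # V" by (intro pos_cong_Cons pos_cong_far far_sym[OF ik])
      finally show "X \<approx> j # i # k # V" .
      note Z'(2)
      also have "k # Z' \<approx> k # i # j # V" by (intro pos_cong_Cons V)
      also have "\<dots> \<approx> i # k # j # V" by (intro pos_cong_far far_sym[OF ik])
      also have "\<dots> \<approx> i # j # k # V" by (intro pos_cong_Cons pos_cong_far kj)
      finally show "Y \<approx> i # j # k # V" .
    qed
  next
    case 3
    obtain V where V: "Z \<approx> j # V" "Z' \<approx> i # V" using compat_far[OF 3 IH[OF len eq]] .
    show ?thesis
    proof (rule compat_farI[OF 3])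
      note Z(1)
      also have "k # Z \<approx> k # j # V" by (intro pos_cong_Cons V)
      also have "\<dots> \<approx> j # k # V" by (intro pos_cong_far kj)
      finally show "X \<approx> j # k # V" .
      note Z'(2)
      also have "k # Z' \<approx> k # i # V" by (intro pos_cong_Cons V)
      also have "\<dots> \<approx> i # k # V" by (intro pos_cong_far far_sym[OF ik])
      finally show "Y \<approx> i # k # V" .
    qed
  qed
qed

text \<open>The harder case has \<open>i\<close>, \<open>j\<close>, \<open>k\<close> consecutive
  with \<open>j\<close> in the middle. Three descents to shorter words then reach the half twist on
  four strands, of length 6, as the common multiple.\<close>

lemma compat_trans_far_adj:
  assumes N: "length W = N" and ik: "far i k" and kj: "adj k j"
    and c: "compat i X k W" "compat k W j Y"
  shows "compat i X j Y"
proof -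
  obtain Z where Z: "X \<approx> k # Z" "W \<approx> i # Z" using compat_far[OF ik c(1)] .
  obtain Z' where Z': "W \<approx> j # k # Z'" "Y \<approx> k # j # Z'" using compat_adj[OF kj c(2)] .
  have eq: "i # Z \<approx> j # k # Z'" using Z(2) Z'(1) pos_cong_sym pos_cong_trans by blast
  have len: "length Z < N" using pos_cong_length_set[OF Z(2)] N by auto
  have len': "length Z' < N" using pos_cong_length_set[OF Z'(1)] N by auto
  have ij: "i \<noteq> j" using ik kj by (auto simp: far_def adj_def)
  have ki: "far k i" using far_sym[OF ik] .
  have jk: "adj j k" using adj_sym[OF kj] .
  consider "adj i j" | "far i j" using index_cases ij by blast
  then show ?thesis
  proof cases
    case 1
    obtain V where V: "Z \<approx> j # i # V" "k # Z' \<approx> i # j # V"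
      using compat_adj[OF 1 IH[OF len eq]] .
    obtain U where U: "Z' \<approx> i # U" "j # V \<approx> k # U"
      using compat_far[OF ki IH[OF len' V(2)]] .
    have "length V < N" using pos_cong_length_set[OF V(1)] len by auto
    then obtain T where T: "V \<approx> k # j # T" "U \<approx> j # k # T"
      using compat_adj[OF jk IH[OF _ U(2)]] by blast
    show ?thesis
    proof (rule compat_adjI[OF 1])
      note Z(1)
      also have "k # Z \<approx> k # j # i # V" by (intro pos_cong_Cons V)
      also have "\<dots> \<approx> k # j # i # k # j # T" by (intro pos_cong_Cons T)
      also have "\<dots> \<approx> k # j # k # i # j # T" by (intro pos_cong_Cons pos_cong_far ik)
      also have "\<dots> \<approx> j # k # j # i # j # T" by (intro pos_cong_adj kj)
      also have "\<dots> \<approx> j # k # i # j # i # T"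
        by (intro pos_cong_Cons pos_cong_adj adj_sym[OF 1])
      also have "\<dots> \<approx> j # i # k # j # i # T" by (intro pos_cong_Cons pos_cong_far ki)
      finally show "X \<approx> j # i # k # j # i # T" .
      note Z'(2)
      also have "k # j # Z' \<approx> k # j # i # U" by (intro pos_cong_Cons U)
      also have "\<dots> \<approx> k # j # i # j # k # T" by (intro pos_cong_Cons T)
      also have "\<dots> \<approx> k # i # j # i # k # T"
        by (intro pos_cong_Cons pos_cong_adj adj_sym[OF 1])
      also have "\<dots> \<approx> k # i # j # k # i # T" by (intro pos_cong_Cons pos_cong_far ik)
      also have "\<dots> \<approx> i # k # j # k # i # T" by (intro pos_cong_far ki)
      also have "\<dots> \<approx> i # j # k # j # i # T" by (intro pos_cong_Cons pos_cong_adj kj)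
      finally show "Y \<approx> i # j # k # j # i # T" .
    qed
  next
    case 2
    obtain V where V: "Z \<approx> j # V" "k # Z' \<approx> i # V" using compat_far[OF 2 IH[OF len eq]] .
    obtain U where U: "Z' \<approx> i # U" "V \<approx> k # U" using compat_far[OF ki IH[OF len' V(2)]] .
    show ?thesis
    proof (rule compat_farI[OF 2])
      note Z(1)
      also have "k # Z \<approx> k # j # V" by (intro pos_cong_Cons V)
      also have "\<dots> \<approx> k # j # k # U" by (intro pos_cong_Cons U)
      also have "\<dots> \<approx> j # k # j # U" by (intro pos_cong_adj kj)
      finally show "X \<approx> j # k # j # U" .
      note Z'(2)
      also have "k # j # Z' \<approx> k # j # i # U" by (intro pos_cong_Cons U)
      also have "\<dots> \<approx> k # i # j # U" by (intro pos_cong_Cons pos_cong_far far_sym[OF 2])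
      also have "\<dots> \<approx> i # k # j # U" by (intro pos_cong_far ki)
      finally show "Y \<approx> i # k # j # U" .
    qed
  qed
qed

text \<open>If \<open>i\<close> and \<open>j\<close> are the two neighbours of \<open>k\<close>, the
  word \<open>V\<close> has two factorizations starting with \<open>k\<close>; cancelling
  \<open>k\<close> and descending once more gives \<open>T\<close>. The common multiple is again the
  half twist on four strands.\<close>

lemma compat_trans_adj_adj:
  assumes N: "length W = N" and ik: "adj i k" and kj: "adj k j"
    and c: "compat i X k W" "compat k W j Y"
  shows "compat i X j Y"
proof -
  obtain Z where Z: "X \<approx> k # i # Z" "W \<approx> i # k # Z" using compat_adj[OF ik c(1)] .
  obtain Z' where Z': "W \<approx> j # k # Z'" "Y \<approx> k # j # Z'" using compat_adj[OF kj c(2)] .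
  have eq: "i # k # Z \<approx> j # k # Z'" using Z(2) Z'(1) pos_cong_sym pos_cong_trans by blast
  have len: "length (k # Z) < N" using pos_cong_length_set[OF Z(2)] N by auto
  have len': "length Z' < N" using pos_cong_length_set[OF Z'(1)] N by auto
  have ki: "adj k i" using adj_sym[OF ik] .
  consider "i = j" | "far i j" using ik kj by (auto simp: adj_def far_def)
  then show ?thesis
  proof cases
    case 1
    have "k # Z \<approx> k # Z'" using IH_cancel[OF len] eq 1 by blast
    then have "Z \<approx> Z'" using IH_cancel len by auto
    then have "k # i # Z \<approx> k # j # Z'" using 1 by (auto intro: pos_cong_Cons)
    then have "X \<approx> Y" using Z(1) Z'(2) by (meson pos_cong_sym pos_cong_trans)
    then show ?thesis using 1 by (simp add: compat_same)
  next
    case 2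
    obtain V where V: "k # Z \<approx> j # V" "k # Z' \<approx> i # V"
      using compat_far[OF 2 IH[OF len eq]] .
    have "length Z < N" using len by auto
    then obtain U where U: "Z \<approx> j # k # U" "V \<approx> k # j # U"
      using compat_adj[OF kj IH[OF _ V(1)]] by blast
    obtain U' where U': "Z' \<approx> i # k # U'" "V \<approx> k # i # U'"
      using compat_adj[OF ki IH[OF len' V(2)]] .
    have lV: "length V < N" using pos_cong_length_set[OF V(1)] len by auto
    have lU: "length (j # U) < N" "length U < N" using pos_cong_length_set[OF U(2)] lV by auto
    have "k # j # U \<approx> k # i # U'" using U(2) U'(2) pos_cong_sym pos_cong_trans by blast
    then have "j # U \<approx> i # U'" using IH_cancel lU by blast
    then obtain T where T: "U \<approx> i # T" "U' \<approx> j # T"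
      using compat_far[OF far_sym[OF 2] IH] lU by blast
    show ?thesis
    proof (rule compat_farI[OF 2])
      note Z(1)
      also have "k # i # Z \<approx> k # i # j # k # U" by (intro pos_cong_Cons U)
      also have "\<dots> \<approx> k # i # j # k # i # T" by (intro pos_cong_Cons T)
      also have "\<dots> \<approx> k # j # i # k # i # T" by (intro pos_cong_Cons pos_cong_far 2)
      also have "\<dots> \<approx> k # j # k # i # k # T" by (intro pos_cong_Cons pos_cong_adj ik)
      also have "\<dots> \<approx> j # k # j # i # k # T" by (intro pos_cong_adj kj)
      finally show "X \<approx> j # k # j # i # k # T" .
      note Z'(2)
      also have "k # j # Z' \<approx> k # j # i # k # U'" by (intro pos_cong_Cons U')
      also have "\<dots> \<approx> k # j # i # k # j # T" by (intro pos_cong_Cons T)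
      also have "\<dots> \<approx> k # i # j # k # j # T" by (intro pos_cong_Cons pos_cong_far far_sym[OF 2])
      also have "\<dots> \<approx> k # i # k # j # k # T"
        by (intro pos_cong_Cons pos_cong_adj adj_sym[OF kj])
      also have "\<dots> \<approx> i # k # i # j # k # T" by (intro pos_cong_adj ki)
      also have "\<dots> \<approx> i # k # j # i # k # T" by (intro pos_cong_Cons pos_cong_far 2)
      finally show "Y \<approx> i # k # j # i # k # T" .
    qed
  qed
qed

lemma compat_trans:
  assumes N: "length W = N" and c: "compat i X k W" "compat k W j Y"
  shows "compat i X j Y"
proof -
  consider "i = k" | "k = j" | "adj i k" "adj k j" | "far i k" "far k j"
    | "far i k" "adj k j" | "adj i k" "far k j"
    using index_cases by metis
  then show ?thesis
  proof cases
    case 1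
    then show ?thesis using c compat_cong compat_same by blast
  next
    case 2
    then have "Y \<approx> W" using c compat_same pos_cong_sym by blast
    then show ?thesis using c compat_cong compat_sym 2 by blast
  next
    case 3
    then show ?thesis using compat_trans_adj_adj N c by blast
  next
    case 4
    then show ?thesis using compat_trans_far_far N c by blast
  next
    case 5
    then show ?thesis using compat_trans_far_adj N c by blast
  next
    case 6
    then show ?thesis
      using compat_trans_far_adj N c compat_sym far_sym adj_sym by blast
  qed
qed

end

lemma pos_step_compat: "pos_step (i # X) (j # Y) \<Longrightarrow> compat i X j Y"
  by (erule pos_step.cases)
    (auto simp: compat_same pos_cong_def intro: compat_farI compat_adjI)

lemma pos_cong_compat: "i # X \<approx> j # Y \<Longrightarrow> compat i X j Y"
proof (induction "length X" arbitrary: i X j Y rule: less_induct)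
  case less
  \<comment> \<open>The invariant along the chain: every intermediate word has a tail as long as
    \<open>X\<close>, the length at which \<open>compat_trans\<close> is available.\<close>
  have "\<exists>k W. V = k # W \<and> length W = length X \<and> compat i X k W"
    if "pos_step\<^sup>*\<^sup>* (i # X) V" for V
    using that
  proof (induction rule: rtranclp_induct)
    case base
    then show ?case by (simp add: compat_same)
  next
    case (step V V')
    then obtain k W where W: "V = k # W" "length W = length X" "compat i X k W" by blast
    have "length V' = length V" using step(2) pos_cong_length_set[of V V']
      by (simp add: pos_cong_def r_into_rtranclp)
    then obtain k' W' where W': "V' = k' # W'" "length W' = length X"
      using W by (cases V') auto
    have "compat i X k' W'"
      using compat_trans[OF less(1) W(2) W(3)] pos_step_compat step(2) W W' by blast
    then show ?case using W' by blast
  qed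
  from this[of "j # Y"] less(2) show ?case by (auto simp: pos_cong_def)
qed

text \<open>The case \<open>i = j\<close> of Garside's lemma, where both complements are
  empty.\<close>

lemma pos_cong_Cons_cancel: "i # X \<approx> i # Y \<Longrightarrow> X \<approx> Y"
  using pos_cong_compat compat_same by blast

lemma pos_cong_append_cancel: "u @ X \<approx> u @ Y \<Longrightarrow> X \<approx> Y"
  by (induction u) (auto dest: pos_cong_Cons_cancel)

section \<open>Embedding positive braids into the braid group\<close>

definition word_power :: "nat \<Rightarrow> 'a list \<Rightarrow> 'a list" where
  "word_power k w = concat (replicate k w)"

lemma word_power_0 [simp]: "word_power 0 w = []"
  by (simp add: word_power_def)

lemma word_power_Suc [simp]: "word_power (Suc k) w = w @ word_power k w"
  by (simp add: word_power_def)

lemma word_power_add: "word_power (k + l) w = word_power k w @ word_power l w"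
  by (simp add: word_power_def replicate_add)

lemma set_word_power: "set (word_power k w) \<subseteq> set w"
  by (auto simp: word_power_def)

section \<open>The rotation word and the centrality of the full twist\<close>

definition rotation :: "nat \<Rightarrow> nat list" where
  "rotation n = [1..<n]"

definition full_twist :: "nat \<Rightarrow> nat list" where
  "full_twist n = word_power n (rotation n)"

lemma set_rotation [simp]: "set (rotation n) = {1..<n}"
  by (simp add: rotation_def)

lemma set_full_twist: "set (full_twist n) \<subseteq> {1..<n}"
  using set_word_power[of n "rotation n"] by (simp add: full_twist_def)

lemma pos_cong_move:
  "\<forall>x\<in>set u. far a x \<Longrightarrow> u @ a # v \<approx> a # u @ v"
proof (induction u)
  case (Cons x u)
  have "x # u @ a # v \<approx> x # a # u @ v" using Cons by (intro pos_cong_Cons) auto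
  also have "\<dots> \<approx> a # x # u @ v" using Cons by (intro pos_cong_far) (auto simp: far_sym)
  finally show ?case by simp
qed simp

text \<open>The letter \<open>i\<close> moves left past the letters from \<open>i + 2\<close> on,
  the braid relation turns it into \<open>Suc i\<close>, and that letter moves left past the letters
  below \<open>i\<close>.\<close>

lemma rotation_shift:
  assumes "1 \<le> i" "i + 1 < n"
  shows "rotation n @ i # v \<approx> Suc i # rotation n @ v"
proof -
  have "[1..<n] = [1..<i] @ [i..<n]" using upt_add_eq_append[of 1 i "n - i"] assms by simp
  also have "[i..<n] = i # Suc i # [i + 2..<n]" using assms by (simp add: upt_conv_Cons)
  finally have r: "rotation n = [1..<i] @ i # Suc i # [i + 2..<n]" by (simp add: rotation_def)
  have "rotation n @ i # v = [1..<i] @ i # Suc i # [i + 2..<n] @ i # v" by (simp add: r)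
  also have "\<dots> \<approx> [1..<i] @ i # Suc i # i # [i + 2..<n] @ v"
    by (intro pos_cong_append_left pos_cong_Cons pos_cong_move) (auto simp: far_def)
  also have "\<dots> \<approx> [1..<i] @ Suc i # i # Suc i # [i + 2..<n] @ v"
    by (intro pos_cong_append_left pos_cong_adj) (auto simp: adj_def)
  also have "\<dots> \<approx> Suc i # [1..<i] @ i # Suc i # [i + 2..<n] @ v"
    by (intro pos_cong_move) (auto simp: far_def)
  finally show ?thesis by (simp add: r)
qed

lemma rotation_shift_word:
  "set w \<subseteq> {1..<n - 1} \<Longrightarrow> rotation n @ w @ v \<approx> map Suc w @ rotation n @ v"
proof (induction w)
  case (Cons i w)
  have "rotation n @ i # w @ v \<approx> Suc i # rotation n @ w @ v"
    using Cons by (intro rotation_shift) auto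
  also have "\<dots> \<approx> Suc i # map Suc w @ rotation n @ v"
    using Cons by (intro pos_cong_Cons) auto
  finally show ?case by simp
qed simp

text \<open>One conjugation need not take the last generator to a generator, but two take it to the
  first. Splitting off the last letter of one rotation and shifting the rest through the other
  leaves a complete rotation in front, once the leading 1 is included.\<close>

lemma rotation_wrap:
  assumes "2 \<le> n"
  shows "rotation n @ rotation n @ (n - 1) # v \<approx> 1 # rotation n @ rotation n @ v"
proof -
  obtain k where n: "n = Suc (Suc k)" using assms by (metis add_2_eq_Suc le_Suc_ex)
  have l: "rotation n = [1..<n - 1] @ [n - 1]" by (simp add: rotation_def n)
  have "rotation n = 1 # [Suc 1..<n]" by (simp add: rotation_def n upt_conv_Cons del: upt_Suc)
  also have "[Suc 1..<n] = map Suc [1..<n - 1]" by (simp add: n map_Suc_upt del: upt_Suc)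
  finally have r: "rotation n = 1 # map Suc [1..<n - 1]" .
  have "1 # rotation n @ rotation n @ v = 1 # rotation n @ [1..<n - 1] @ (n - 1) # v"
    by (subst (2) l) simp
  also have "\<dots> \<approx> 1 # map Suc [1..<n - 1] @ rotation n @ (n - 1) # v"
    by (intro pos_cong_Cons rotation_shift_word) auto
  also have "\<dots> = rotation n @ rotation n @ (n - 1) # v"
    by (subst (2) r) simp
  finally show ?thesis by (rule pos_cong_sym)
qed

lemma rotation_power_shift:
  "1 \<le> i \<Longrightarrow> i + k < n \<Longrightarrow>
    word_power k (rotation n) @ i # v \<approx> (i + k) # word_power k (rotation n) @ v"
proof (induction k)
  case (Suc k)
  have "rotation n @ word_power k (rotation n) @ i # v
      \<approx> rotation n @ (i + k) # word_power k (rotation n) @ v"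
    using Suc by (intro pos_cong_append_left) auto
  also have "\<dots> \<approx> Suc (i + k) # rotation n @ word_power k (rotation n) @ v"
    using Suc by (intro rotation_shift) auto
  finally show ?case by simp
qed simp

text \<open>The \<open>n\<close> rotations split as \<open>i - 1\<close>, 2 and
  \<open>n - 1 - i\<close>. Read from the right, they carry \<open>i\<close> up to
  \<open>n - 1\<close>, wrap it round to 1, and carry 1 back up to \<open>i\<close>.\<close>

lemma full_twist_central_letter:
  assumes i: "i \<in> {1..<n}"
  shows "full_twist n @ i # v \<approx> i # full_twist n @ v"
proof -
  let ?R = "\<lambda>k. word_power k (rotation n)"
  have "(i - 1) + (Suc (Suc 0) + (n - 1 - i)) = n" using i by auto
  then have T: "full_twist n = ?R (i - 1) @ rotation n @ rotation n @ ?R (n - 1 - i)"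
    using word_power_add[of "i - 1" "Suc (Suc 0) + (n - 1 - i)" "rotation n"]
    by (simp only: full_twist_def) (simp only: word_power_add word_power_Suc word_power_0 append_Nil2 append_assoc)
  have "full_twist n @ i # v = ?R (i - 1) @ rotation n @ rotation n @ ?R (n - 1 - i) @ i # v"
    by (simp add: T)
  also have "\<dots> \<approx> ?R (i - 1) @ rotation n @ rotation n @ (i + (n - 1 - i)) # ?R (n - 1 - i) @ v"
    using i by (intro pos_cong_append_left rotation_power_shift) auto
  also have "i + (n - 1 - i) = n - 1" using i by auto
  also have "?R (i - 1) @ rotation n @ rotation n @ (n - 1) # ?R (n - 1 - i) @ v
      \<approx> ?R (i - 1) @ 1 # rotation n @ rotation n @ ?R (n - 1 - i) @ v"
    using i by (intro pos_cong_append_left rotation_wrap) auto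
  also have "\<dots> \<approx> (1 + (i - 1)) # ?R (i - 1) @ rotation n @ rotation n @ ?R (n - 1 - i) @ v"
    using i by (intro rotation_power_shift) auto
  also have "\<dots> = i # full_twist n @ v" using i by (simp add: T)
  finally show ?thesis .
qed

lemma full_twist_central:
  "set u \<subseteq> {1..<n} \<Longrightarrow> full_twist n @ u @ v \<approx> u @ full_twist n @ v"
proof (induction u)
  case (Cons i u)
  have "full_twist n @ i # u @ v \<approx> i # full_twist n @ u @ v"
    using Cons by (intro full_twist_central_letter) auto
  also have "\<dots> \<approx> i # u @ full_twist n @ v" using Cons by (intro pos_cong_Cons) auto
  finally show ?case by simp
qed simp

lemma full_twist_power_central:
  "set u \<subseteq> {1..<n} \<Longrightarrow>
    word_power k (full_twist n) @ u @ v \<approx> u @ word_power k (full_twist n) @ v"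
proof (induction k)
  case (Suc k)
  have "full_twist n @ word_power k (full_twist n) @ u @ v
      \<approx> full_twist n @ u @ word_power k (full_twist n) @ v"
    using Suc by (intro pos_cong_append_left) auto
  also have "\<dots> \<approx> u @ full_twist n @ word_power k (full_twist n) @ v"
    using Suc by (intro full_twist_central) auto
  finally show ?case by simp
qed simp

text \<open>The quotient of the full twist by \<open>i\<close>: the first letter of the
  \<open>i\<close>-th rotation is deleted, since the \<open>i - 1\<close> rotations before it carry
  that letter 1 to an initial \<open>i\<close>.\<close>

definition twist_complement :: "nat \<Rightarrow> nat \<Rightarrow> nat list" where
  "twist_complement n i =
    word_power (i - 1) (rotation n) @ [2..<n] @ word_power (n - i) (rotation n)"

lemma set_twist_complement: "set (twist_complement n i) \<subseteq> {1..<n}"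
  using set_word_power[of _ "rotation n"] by (fastforce simp: twist_complement_def)

lemma twist_complement_right:
  assumes i: "i \<in> {1..<n}"
  shows "i # twist_complement n i \<approx> full_twist n"
proof -
  let ?R = "\<lambda>k. word_power k (rotation n)"
  have r: "rotation n = 1 # [2..<n]"
    using i by (simp add: rotation_def upt_conv_Cons numeral_2_eq_2)
  have n: "(i - 1) + Suc (n - i) = n" using i by auto
  have "full_twist n = ?R (i - 1) @ 1 # [2..<n] @ ?R (n - i)"
    unfolding full_twist_def
    using word_power_add[of "i - 1" "Suc (n - i)" "rotation n"]
    by (simp only: full_twist_def n word_power_Suc) (simp only: r append_Cons)
  also have "\<dots> \<approx> (1 + (i - 1)) # ?R (i - 1) @ [2..<n] @ ?R (n - i)"
    using i by (intro rotation_power_shift) auto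
  finally show ?thesis using i by (auto simp: twist_complement_def intro: pos_cong_sym)
qed

text \<open>By centrality a right complement is also a left one: multiply by \<open>i\<close> on the
  right, move it through the twist, and cancel the leading \<open>i\<close>.\<close>

lemma twist_complement_left:
  assumes i: "i \<in> {1..<n}"
  shows "twist_complement n i @ [i] \<approx> full_twist n"
proof (rule pos_cong_Cons_cancel)
  have "i # twist_complement n i @ [i] \<approx> full_twist n @ [i]"
    using pos_cong_append_right[OF twist_complement_right[OF i], of "[i]"] by simp
  also have "\<dots> \<approx> i # full_twist n" using full_twist_central_letter[OF i, of "[]"] by simp
  finally show "i # twist_complement n i @ [i] \<approx> i # full_twist n" .
qed

text \<open>With \<open>T\<close> the full twist, \<open>\<sigma>\<^sub>i\<^sup>-\<^sup>1\<close> is \<open>T\<^sup>-\<^sup>1\<close> times the positive word \<open>twist_complement n i\<close>; so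
  \<open>positive_part n w\<close> represents \<open>T\<^sup>k w\<close>, where \<open>k = neg_count w\<close>.\<close>

fun positive_part :: "nat \<Rightarrow> braid_word \<Rightarrow> nat list" where
  "positive_part n [] = []"
| "positive_part n ((i, b) # w) = (if b then [i] else twist_complement n i) @ positive_part n w"

definition neg_count :: "braid_word \<Rightarrow> nat" where
  "neg_count w = length (filter (\<lambda>a. \<not> snd a) w)"

lemma neg_count_simps [simp]:
  "neg_count [] = 0"
  "neg_count ((i, b) # w) = (if b then neg_count w else Suc (neg_count w))"
  "neg_count (u @ v) = neg_count u + neg_count v"
  by (simp_all add: neg_count_def)

lemma positive_part_append [simp]:
  "positive_part n (u @ v) = positive_part n u @ positive_part n v"
  by (induction u rule: positive_part.induct) auto

lemma set_positive_part: "u \<in> braid_words n \<Longrightarrow> set (positive_part n u) \<subseteq> {1..<n}"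
proof (induction u)
  case (Cons a u)
  obtain i b where a: "a = (i, b)" by (cases a)
  have "i \<in> {1..<n}" "u \<in> braid_words n" using Cons.prems a by (auto simp: braid_words_def)
  then show ?case using Cons.IH set_twist_complement[of n i] by (simp add: a)
qed simp

lemma set_twist_power: "set (word_power k (full_twist n)) \<subseteq> {1..<n}"
  using set_word_power set_full_twist by (rule subset_trans)

text \<open>Cross-multiplication of fractions with powers of the full twist as denominators:
  congruent words may contain different numbers of inverse letters. Transitivity is where left
  cancellation in the positive monoid enters.\<close>

lemma positive_part_cong:
  "(u, v) \<in> braid_cong n \<Longrightarrow>
    word_power (neg_count v) (full_twist n) @ positive_part n u
      \<approx> word_power (neg_count u) (full_twist n) @ positive_part n v"
proof (induction rule: braid_cong.induct)
  case (sym u v)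
  then show ?case by (rule_tac pos_cong_sym)
next
  case (trans u v w)
  let ?T = "\<lambda>k. word_power k (full_twist n)" and ?p = "positive_part n"
  have comm: "?T k @ ?T l @ x \<approx> ?T l @ ?T k @ x" for k l x
    by (intro full_twist_power_central set_twist_power)
  have "?T (neg_count v) @ ?T (neg_count w) @ ?p u \<approx> ?T (neg_count w) @ ?T (neg_count v) @ ?p u"
    by (rule comm)
  also have "\<dots> \<approx> ?T (neg_count w) @ ?T (neg_count u) @ ?p v"
    by (intro pos_cong_append_left trans)
  also have "\<dots> \<approx> ?T (neg_count u) @ ?T (neg_count w) @ ?p v" by (rule comm)
  also have "\<dots> \<approx> ?T (neg_count u) @ ?T (neg_count v) @ ?p w"
    by (intro pos_cong_append_left trans)
  also have "\<dots> \<approx> ?T (neg_count v) @ ?T (neg_count u) @ ?p w" by (rule comm)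
  finally show ?case by (rule pos_cong_append_cancel)
next
  case (append u u' v v')
  let ?T = "\<lambda>k. word_power k (full_twist n)" and ?p = "positive_part n"
  have u: "set (?p u') \<subseteq> {1..<n}" "set (?p u) \<subseteq> {1..<n}"
    using append(1) by (auto dest!: braid_cong_words set_positive_part)
  have comm: "?T k @ ?T l @ x \<approx> ?T l @ ?T k @ x" for k l x
    by (intro full_twist_power_central set_twist_power)
  have "?T (neg_count (u' @ v')) @ ?p (u @ v)
      = ?T (neg_count u') @ ?T (neg_count v') @ ?p u @ ?p v"
    by (simp add: word_power_add)
  also have "\<dots> \<approx> ?T (neg_count u') @ ?p u @ ?T (neg_count v') @ ?p v"
    using u by (intro pos_cong_append_left full_twist_power_central)
  also have "\<dots> = (?T (neg_count u') @ ?p u) @ (?T (neg_count v') @ ?p v)" by simp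
  also have "\<dots> \<approx> (?T (neg_count u) @ ?p u') @ (?T (neg_count v) @ ?p v')"
    by (intro pos_cong_append append)
  also have "\<dots> = ?T (neg_count u) @ ?p u' @ ?T (neg_count v) @ ?p v'" by simp
  also have "\<dots> \<approx> ?T (neg_count u) @ ?T (neg_count v) @ ?p u' @ ?p v'"
    using u by (intro pos_cong_append_left pos_cong_sym[OF full_twist_power_central])
  finally show ?case by (simp add: word_power_add)
next
  case (cancel i b)
  then show ?case using twist_complement_left[of i n] twist_complement_right[of i n] by simp
next
  case (far i j)
  then show ?case by (auto intro: pos_cong_far simp: far_def)
next
  case (braid i)
  then show ?case by (auto intro: pos_cong_adj simp: adj_def)
qed auto

section \<open>Positive words inside the braid group\<close>

definition pos_word :: "nat list \<Rightarrow> braid_word" where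
  "pos_word u = map (\<lambda>i. (i, True)) u"

lemma pos_word_simps [simp]:
  "pos_word [] = []"
  "pos_word (i # u) = (i, True) # pos_word u"
  "pos_word (u @ v) = pos_word u @ pos_word v"
  by (simp_all add: pos_word_def)

lemma pos_word_in_braid_words: "pos_word u \<in> braid_words n \<longleftrightarrow> set u \<subseteq> {1..<n}"
  by (auto simp: pos_word_def braid_words_def)

lemma positive_part_pos_word [simp]:
  "positive_part n (pos_word u) = u" "neg_count (pos_word u) = 0"
  by (induction u) auto

lemma pos_step_braid_cong:
  "pos_step u v \<Longrightarrow> set u \<subseteq> {1..<n} \<Longrightarrow> (pos_word u, pos_word v) \<in> braid_cong n"
proof (induction rule: pos_step.induct)
  case (far i j v)
  have v: "(pos_word v, pos_word v) \<in> braid_cong n"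
    using far by (auto intro!: braid_cong.refl simp: pos_word_in_braid_words)
  have "([(i, True), (j, True)], [(j, True), (i, True)]) \<in> braid_cong n"
    using far braid_cong.far[of i j n] braid_cong.sym[OF braid_cong.far[of j i n]]
    by (auto simp: far_def)
  from braid_cong.append[OF this v] show ?case by simp
next
  case (adj i j v)
  have v: "(pos_word v, pos_word v) \<in> braid_cong n"
    using adj by (auto intro!: braid_cong.refl simp: pos_word_in_braid_words)
  have "([(i, True), (j, True), (i, True)], [(j, True), (i, True), (j, True)]) \<in> braid_cong n"
    using adj braid_cong.braid[of i n] braid_cong.sym[OF braid_cong.braid[of j n]]
    by (auto simp: adj_def)
  from braid_cong.append[OF this v] show ?case by simp
next
  case (Cons u v a)
  have "([(a, True)], [(a, True)]) \<in> braid_cong n"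
    using Cons by (auto intro!: braid_cong.refl simp: braid_words_def)
  from braid_cong.append[OF this Cons.IH] Cons.prems show ?case by simp
qed

lemma pos_cong_braid_cong:
  assumes "u \<approx> v" "set u \<subseteq> {1..<n}"
  shows "(pos_word u, pos_word v) \<in> braid_cong n"
proof -
  have "pos_step\<^sup>*\<^sup>* u v" using assms by (simp add: pos_cong_def)
  then show ?thesis
  proof (induction rule: rtranclp_induct)
    case base
    then show ?case using assms by (auto intro: braid_cong.refl simp: pos_word_in_braid_words)
  next
    case (step v w)
    have "set v \<subseteq> {1..<n}" using braid_cong_words[OF step.IH] by (simp add: pos_word_in_braid_words)
    then show ?case using step pos_step_braid_cong braid_cong.trans by blast
  qed
qed

text \<open>Positive words have no inverse letters, so the denominators in
  \<open>positive_part_cong\<close> vanish. Thus the positive monoid embeds in the braid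
  group.\<close>

lemma pos_word_braid_cong_iff:
  assumes "set u \<subseteq> {1..<n}"
  shows "(pos_word u, pos_word v) \<in> braid_cong n \<longleftrightarrow> u \<approx> v"
proof
  assume "(pos_word u, pos_word v) \<in> braid_cong n"
  from positive_part_cong[OF this] show "u \<approx> v" by simp
qed (use assms pos_cong_braid_cong in blast)

section \<open>Lattice orders defined by a positive cone\<close>

text \<open>\<open>P\<close> is the positive monoid, \<open>S\<close> its set of atoms,
  \<open>L\<close> an additive length, and \<open>T\<close> a central element whose powers clear
  denominators. Least common multiples are assumed for atoms only; they are phrased through
  membership in \<open>P\<close> because the order is defined afterwards.\<close>

locale garside_cone = group G for G (structure) +
  fixes P S :: "'a set" and L :: "'a \<Rightarrow> int" and T :: 'a
  assumes S_carrier: "S \<subseteq> carrier G"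
    and P_one: "\<one> \<in> P"
    and P_carrier: "P \<subseteq> carrier G"
    and P_mult: "x \<in> P \<Longrightarrow> y \<in> P \<Longrightarrow> x \<otimes> y \<in> P"
    and S_subset_P: "S \<subseteq> P"
    and P_cases: "x \<in> P \<Longrightarrow> x = \<one> \<or> (\<exists>s\<in>S. \<exists>y\<in>P. x = s \<otimes> y)"
    and L_mult: "x \<in> carrier G \<Longrightarrow> y \<in> carrier G \<Longrightarrow> L (x \<otimes> y) = L x + L y"
    and L_S: "s \<in> S \<Longrightarrow> L s = 1"
    and L_P: "x \<in> P \<Longrightarrow> 0 \<le> L x"
    and S_finite: "finite S"
    and T_P: "T \<in> P"
    and T_central: "x \<in> carrier G \<Longrightarrow> T \<otimes> x = x \<otimes> T"
    and T_bound: "x \<in> carrier G \<Longrightarrow> \<exists>k::nat. T [^] k \<otimes> x \<in> P"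
    and S_lcm: "s \<in> S \<Longrightarrow> t \<in> S \<Longrightarrow>
      \<exists>j\<in>P. inv s \<otimes> j \<in> P \<and> inv t \<otimes> j \<in> P \<and>
        (\<forall>c\<in>P. inv s \<otimes> c \<in> P \<longrightarrow> inv t \<otimes> c \<in> P \<longrightarrow> inv j \<otimes> c \<in> P)"
begin

definition le :: "'a \<Rightarrow> 'a \<Rightarrow> bool" (infix \<open>\<preceq>\<close> 50) where
  "x \<preceq> y \<longleftrightarrow> x \<in> carrier G \<and> y \<in> carrier G \<and> inv x \<otimes> y \<in> P"

lemma P_closed [simp, intro]: "x \<in> P \<Longrightarrow> x \<in> carrier G"
  using P_carrier by blast

lemma S_closed [simp, intro]: "x \<in> S \<Longrightarrow> x \<in> carrier G"
  using S_carrier by blast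

lemma L_one [simp]: "L \<one> = 0"
  using L_mult[of \<one> \<one>] by simp

lemma L_inv: "x \<in> carrier G \<Longrightarrow> L (inv x) = - L x"
  using L_mult[of x "inv x"] by simp

lemma L_pow: "x \<in> carrier G \<Longrightarrow> L (x [^] (k::nat)) = int k * L x"
  by (induction k) (auto simp: L_mult algebra_simps)

lemma one_le_iff: "\<one> \<preceq> x \<longleftrightarrow> x \<in> P"
  by (auto simp: le_def)

lemma le_refl: "x \<in> carrier G \<Longrightarrow> x \<preceq> x"
  by (simp add: le_def P_one)

lemma mult_inv_cancel [simp]:
  "x \<in> carrier G \<Longrightarrow> y \<in> carrier G \<Longrightarrow> x \<otimes> (inv x \<otimes> y) = y"
  "x \<in> carrier G \<Longrightarrow> y \<in> carrier G \<Longrightarrow> inv x \<otimes> (x \<otimes> y) = y"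
  by (simp_all add: m_assoc[symmetric])

lemma le_closed: "x \<preceq> y \<Longrightarrow> x \<in> carrier G" "x \<preceq> y \<Longrightarrow> y \<in> carrier G"
  by (auto simp: le_def)

lemma le_trans [trans]: "x \<preceq> y \<Longrightarrow> y \<preceq> z \<Longrightarrow> x \<preceq> z"
proof -
  assume h: "x \<preceq> y" "y \<preceq> z"
  then have "(inv x \<otimes> y) \<otimes> (inv y \<otimes> z) \<in> P" by (auto simp: le_def intro: P_mult)
  then show ?thesis using h by (simp add: le_def m_assoc)
qed

lemma le_left_iff [simp]:
  "g \<in> carrier G \<Longrightarrow> x \<in> carrier G \<Longrightarrow> y \<in> carrier G \<Longrightarrow> g \<otimes> x \<preceq> g \<otimes> y \<longleftrightarrow> x \<preceq> y"
  by (simp add: le_def inv_mult_group m_assoc)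

lemma le_mult_P: "x \<in> carrier G \<Longrightarrow> p \<in> P \<Longrightarrow> x \<preceq> x \<otimes> p"
  by (simp add: le_def)

lemma leE:
  assumes "x \<preceq> y"
  obtains p where "p \<in> P" "y = x \<otimes> p"
  using assms that[of "inv x \<otimes> y"] by (simp add: le_def)

lemma le_P: "x \<in> P \<Longrightarrow> x \<preceq> y \<Longrightarrow> y \<in> P"
  using P_mult[of x "inv x \<otimes> y"] by (simp add: le_def)

lemma P_L_cases:
  assumes "x \<in> P"
  obtains "x = \<one>" | s y where "s \<in> S" "y \<in> P" "x = s \<otimes> y" "L x = 1 + L y" "0 \<le> L y"
proof (cases "x = \<one>")
  case False
  then obtain s y where "s \<in> S" "y \<in> P" "x = s \<otimes> y" using P_cases assms by blast
  then show ?thesis using that(2)[of s y] L_P[of y] by (simp add: L_mult L_S)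
qed (rule that(1))

lemma P_L_zero: "x \<in> P \<Longrightarrow> L x = 0 \<Longrightarrow> x = \<one>"
  by (erule P_L_cases) simp_all

text \<open>Lets a conjugate of an atom be recognized as an atom from its length, once it is known
  to be positive.\<close>

lemma P_L_one:
  assumes "x \<in> P" "L x = 1"
  shows "x \<in> S"
  using assms(1)
proof (cases rule: P_L_cases)
  case (2 s y)
  then have "y = \<one>" using assms(2) by (intro P_L_zero) simp_all
  then show ?thesis using 2 by simp
qed (use assms(2) in simp)

lemma L_le_diff: "x \<preceq> y \<Longrightarrow> L (inv x \<otimes> y) = L y - L x"
  by (simp add: le_def L_mult L_inv)

lemma le_L: "x \<preceq> y \<Longrightarrow> L x \<le> L y"
  using L_P[of "inv x \<otimes> y"] L_le_diff[of x y] by (simp add: le_def)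

lemma le_L_eq:
  assumes "x \<preceq> y" "L x = L y"
  shows "x = y"
proof -
  have "inv x \<otimes> y = \<one>" using P_L_zero[of "inv x \<otimes> y"] L_le_diff assms by (simp add: le_def)
  then show ?thesis using assms(1) mult_inv_cancel(1)[of x y] by (simp add: le_def)
qed

lemma le_shift:
  "g \<in> carrier G \<Longrightarrow> x \<in> carrier G \<Longrightarrow> y \<in> carrier G \<Longrightarrow> g \<otimes> x \<preceq> y \<longleftrightarrow> x \<preceq> inv g \<otimes> y"
  by (simp add: le_def inv_mult_group m_assoc)

section \<open>Joins below a common bound, and meets\<close>

lemma S_join:
  assumes "s \<in> S" "t \<in> S"
  obtains j where "j \<in> P" "s \<preceq> j" "t \<preceq> j" "\<And>c. s \<preceq> c \<Longrightarrow> t \<preceq> c \<Longrightarrow> j \<preceq> c"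
proof -
  obtain j where j: "j \<in> P" "inv s \<otimes> j \<in> P" "inv t \<otimes> j \<in> P"
    "\<And>c. c \<in> P \<Longrightarrow> inv s \<otimes> c \<in> P \<Longrightarrow> inv t \<otimes> c \<in> P \<Longrightarrow> inv j \<otimes> c \<in> P"
    using S_lcm[OF assms] by blast
  have "s \<in> P" using assms S_subset_P by blast
  then have "j \<preceq> c" if "s \<preceq> c" "t \<preceq> c" for c
    using that j(4)[of c] le_P[of s c] j(1) by (simp add: le_def)
  then show ?thesis using that[of j] j assms by (simp add: le_def)
qed

text \<open>Induction on the length of the common bound \<open>e\<close>. For first atoms
  \<open>s\<close>, \<open>t\<close> with join \<open>j0\<close>, the joins of \<open>a\<close> and
  of \<open>b\<close> with \<open>j0\<close> are found after removing \<open>s\<close> or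
  \<open>t\<close>; their remainders \<open>u1\<close>, \<open>v1\<close> beyond \<open>j0\<close>
  are joined below \<open>d\<close>. The three bounds used are all shorter than
  \<open>e\<close>.\<close>

lemma conditional_join:
  assumes "a \<in> P" "b \<in> P" "a \<preceq> e" "b \<preceq> e"
  shows "\<exists>j\<in>P. a \<preceq> j \<and> b \<preceq> j \<and> (\<forall>c. a \<preceq> c \<longrightarrow> b \<preceq> c \<longrightarrow> j \<preceq> c)"
  using assms
proof (induction "nat (L e)" arbitrary: a b e rule: less_induct)
  case less
  consider "a = \<one>" | "b = \<one>" | "a \<noteq> \<one>" "b \<noteq> \<one>" by blast
  then show ?case
  proof cases
    case 1
    then show ?thesis using less.prems by (intro bexI[of _ b]) (auto simp: one_le_iff le_refl)
  next
    case 2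
    then show ?thesis using less.prems by (intro bexI[of _ a]) (auto simp: one_le_iff le_refl)
  next
    case 3
    obtain s a' where a: "s \<in> S" "a' \<in> P" "a = s \<otimes> a'" using P_cases less.prems 3 by blast
    obtain t b' where b: "t \<in> S" "b' \<in> P" "b = t \<otimes> b'" using P_cases less.prems 3 by blast
    have sP: "s \<in> P" "t \<in> P" using a b S_subset_P by auto
    have sa: "s \<preceq> a" "t \<preceq> b" using a b by (auto intro: le_mult_P)
    obtain j0 where j0: "j0 \<in> P" "s \<preceq> j0" "t \<preceq> j0"
      and j0_least: "\<And>c. s \<preceq> c \<Longrightarrow> t \<preceq> c \<Longrightarrow> j0 \<preceq> c"
      using S_join[OF a(1) b(1)] by blast
    obtain p where p: "p \<in> P" "j0 = s \<otimes> p" using j0(2) by (rule leE)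
    obtain q where q: "q \<in> P" "j0 = t \<otimes> q" using j0(3) by (rule leE)
    have "j0 \<preceq> e" using j0_least le_trans sa less.prems by blast
    then obtain d where d: "d \<in> P" "e = j0 \<otimes> d" by (rule leE)
    have e: "e = s \<otimes> (p \<otimes> d)" "e = t \<otimes> (q \<otimes> d)"
      using a b p q d by (simp_all add: m_assoc[symmetric])
    have pd: "p \<otimes> d \<in> P" "q \<otimes> d \<in> P" using p q d P_mult by auto
    have Le: "L e = 1 + L (p \<otimes> d)" "L e = 1 + L (q \<otimes> d)"
      using a(1) b(1) pd L_mult[of s "p \<otimes> d"] L_mult[of t "q \<otimes> d"] L_S[of s] L_S[of t]
      unfolding e(1)[symmetric] e(2)[symmetric] by simp_all
    have "L (p \<otimes> d) = L p + L d" using p d by (simp add: L_mult)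
    then have lt: "nat (L (p \<otimes> d)) < nat (L e)" "nat (L (q \<otimes> d)) < nat (L e)" "nat (L d) < nat (L e)"
      using Le pd[THEN L_P] L_P[OF p(1)] L_P[OF d(1)] by linarith+
    have ae: "a' \<preceq> p \<otimes> d" "b' \<preceq> q \<otimes> d"
      using less.prems(3,4) a b pd le_left_iff[of s a' "p \<otimes> d"] le_left_iff[of t b' "q \<otimes> d"]
      unfolding e(1)[symmetric] e(2)[symmetric] by simp_all
    obtain u where u: "a' \<preceq> u" "p \<preceq> u" "\<And>c. a' \<preceq> c \<Longrightarrow> p \<preceq> c \<Longrightarrow> u \<preceq> c"
      using less.hyps[OF lt(1) a(2) p(1) ae(1) le_mult_P[OF P_closed[OF p(1)] d(1)]] by blast
    obtain v where v: "b' \<preceq> v" "q \<preceq> v" "\<And>c. b' \<preceq> c \<Longrightarrow> q \<preceq> c \<Longrightarrow> v \<preceq> c"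
      using less.hyps[OF lt(2) b(2) q(1) ae(2) le_mult_P[OF P_closed[OF q(1)] d(1)]] by blast
    obtain u1 where u1: "u1 \<in> P" "u = p \<otimes> u1" using u(2) by (rule leE)
    obtain v1 where v1: "v1 \<in> P" "v = q \<otimes> v1" using v(2) by (rule leE)
    \<comment> \<open>Needed twice: with \<open>d\<close> it bounds the last recursive join, with an
      arbitrary common multiple it shows leastness.\<close>
    have least: "u1 \<preceq> w" "v1 \<preceq> w" if w: "w \<in> P" "a \<preceq> j0 \<otimes> w" "b \<preceq> j0 \<otimes> w" for w
    proof -
      have "a' \<preceq> p \<otimes> w" "b' \<preceq> q \<otimes> w"
        using w(1) w(2)[unfolded p(2) a(3)] w(3)[unfolded q(2) b(3)] a(1,2) b(1,2) p(1) q(1)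
        by (simp_all add: m_assoc)
      then have "u \<preceq> p \<otimes> w" "v \<preceq> q \<otimes> w" using u v p q w by (auto intro: le_mult_P)
      then show "u1 \<preceq> w" "v1 \<preceq> w" using u1 v1 p q w by auto
    qed
    have "u1 \<preceq> d" "v1 \<preceq> d" using least[OF d(1)] less.prems d(2) by auto
    then obtain h where h: "h \<in> P" "u1 \<preceq> h" "v1 \<preceq> h"
      "\<And>c. u1 \<preceq> c \<Longrightarrow> v1 \<preceq> c \<Longrightarrow> h \<preceq> c"
      using less.hyps[OF lt(3) u1(1) v1(1)] by blast
    show ?thesis
    proof (intro bexI conjI allI impI)
      have "a \<preceq> s \<otimes> u" using a u by (auto simp: le_closed)
      also have "s \<otimes> u = j0 \<otimes> u1" using a p u1 by (simp add: m_assoc)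
      also have "\<dots> \<preceq> j0 \<otimes> h" using j0 h u1 by simp
      finally show "a \<preceq> j0 \<otimes> h" .
      have "b \<preceq> t \<otimes> v" using b v by (auto simp: le_closed)
      also have "t \<otimes> v = j0 \<otimes> v1" using b q v1 by (simp add: m_assoc)
      also have "\<dots> \<preceq> j0 \<otimes> h" using j0 h v1 by simp
      finally show "b \<preceq> j0 \<otimes> h" .
      show "j0 \<otimes> h \<in> P" using j0 h P_mult by blast
    next
      fix c assume c: "a \<preceq> c" "b \<preceq> c"
      then have "j0 \<preceq> c" using j0_least sa le_trans by blast
      then obtain w where w: "w \<in> P" "c = j0 \<otimes> w" by (rule leE)
      then show "j0 \<otimes> h \<preceq> c" using least[OF w(1)] c h j0 by auto
    qed
  qed
qed

lemma T_pow_P: "T [^] (k::nat) \<in> P"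
  by (induction k) (auto intro: P_one P_mult T_P)

text \<open>One power of \<open>T\<close> makes both elements positive, and its inverse then lies
  below both.\<close>

lemma lower_bound:
  assumes "x \<in> carrier G" "y \<in> carrier G"
  obtains b where "b \<preceq> x" "b \<preceq> y"
proof -
  obtain k l :: nat where kl: "T [^] k \<otimes> x \<in> P" "T [^] l \<otimes> y \<in> P"
    using T_bound assms by metis
  have T: "T \<in> carrier G" using T_P by simp
  have "T [^] (l + k) \<otimes> x \<in> P" "T [^] (k + l) \<otimes> y \<in> P"
    using P_mult[OF T_pow_P[of l] kl(1)] P_mult[OF T_pow_P[of k] kl(2)] T assms
    by (simp_all add: nat_pow_mult[symmetric] m_assoc)
  then show ?thesis
    using that[of "inv (T [^] (k + l))"] T assms by (simp add: le_def add.commute)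
qed

text \<open>Lengths of lower bounds of \<open>x\<close> are at most \<open>L x\<close>, so a longest
  common lower bound \<open>M\<close> exists. Its join with another one, formed after translating
  both to positive elements, is again a common lower bound and hence equals
  \<open>M\<close>.\<close>

lemma meet:
  assumes x: "x \<in> carrier G" and y: "y \<in> carrier G"
  obtains M where "M \<preceq> x" "M \<preceq> y" "\<And>c. c \<preceq> x \<Longrightarrow> c \<preceq> y \<Longrightarrow> c \<preceq> M"
proof -
  obtain b where "b \<preceq> x \<and> b \<preceq> y" using lower_bound[OF x y] by blast
  from ex_has_least_nat[of "\<lambda>c. c \<preceq> x \<and> c \<preceq> y", OF this, of "\<lambda>c. nat (L x - L c)"]
  obtain M where M: "M \<preceq> x" "M \<preceq> y"
    "\<And>c. c \<preceq> x \<Longrightarrow> c \<preceq> y \<Longrightarrow> nat (L x - L M) \<le> nat (L x - L c)" by blast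
  have "c \<preceq> M" if c: "c \<preceq> x" "c \<preceq> y" for c
  proof -
    have cl: "M \<in> carrier G" "c \<in> carrier G" using M c le_closed by auto
    obtain d where d: "d \<preceq> M" "d \<preceq> c" using lower_bound[OF cl] .
    have dc: "d \<in> carrier G" using d le_closed by blast
    have P: "inv d \<otimes> M \<in> P" "inv d \<otimes> c \<in> P" using d by (auto simp: le_def)
    obtain j where j: "j \<in> P" "inv d \<otimes> M \<preceq> j" "inv d \<otimes> c \<preceq> j"
      "\<And>e. inv d \<otimes> M \<preceq> e \<Longrightarrow> inv d \<otimes> c \<preceq> e \<Longrightarrow> j \<preceq> e"
      using conditional_join[OF P, of "inv d \<otimes> x"] M(1) c(1) cl dc x by auto
    have up: "d \<otimes> j \<preceq> e" if "M \<preceq> e" "c \<preceq> e" for e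
    proof -
      have e: "e \<in> carrier G" using that le_closed by blast
      then have "j \<preceq> inv d \<otimes> e" using j(4) that cl dc by simp
      then have "d \<otimes> j \<preceq> d \<otimes> (inv d \<otimes> e)" using dc e j(1) by (simp del: mult_inv_cancel)
      then show ?thesis using dc e by simp
    qed
    have low: "M \<preceq> d \<otimes> j" "c \<preceq> d \<otimes> j"
      using j le_left_iff[of d "inv d \<otimes> M" j] le_left_iff[of d "inv d \<otimes> c" j] cl dc by auto
    have dj: "d \<otimes> j \<preceq> x" "d \<otimes> j \<preceq> y" using up M c by auto
    have "L M = L (d \<otimes> j)"
      using M(3)[OF dj] le_L[OF low(1)] le_L[OF dj(1)] le_L[OF M(1)] by auto
    then show ?thesis using le_L_eq[OF low(1)] low(2) by simp
  qed
  then show ?thesis using that M by blast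
qed

lemma finite_meet:
  assumes "finite A" "A \<noteq> {}" "A \<subseteq> carrier G"
  shows "\<exists>M. (\<forall>x\<in>A. M \<preceq> x) \<and> (\<forall>c. (\<forall>x\<in>A. c \<preceq> x) \<longrightarrow> c \<preceq> M)"
  using assms
proof (induction rule: finite_ne_induct)
  case (singleton x)
  then show ?case by (auto intro!: exI[of _ x] le_refl)
next
  case (insert x A)
  then obtain N where N: "\<forall>x\<in>A. N \<preceq> x" "\<forall>c. (\<forall>x\<in>A. c \<preceq> x) \<longrightarrow> c \<preceq> N" by auto
  have "N \<in> carrier G" using N(1) insert(2) le_closed by blast
  then obtain M where M: "M \<preceq> x" "M \<preceq> N" "\<And>c. c \<preceq> x \<Longrightarrow> c \<preceq> N \<Longrightarrow> c \<preceq> M"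
    using meet insert.prems by blast
  then show ?case using N le_trans by (intro exI[of _ M]) (metis insert_iff)
qed

text \<open>Left multiplication by \<open>y\<close> permutes the powers of \<open>y\<close>, hence fixes their meet.\<close>

theorem torsion_free:
  assumes y: "y \<in> carrier G" and k: "0 < k" "y [^] (k::nat) = \<one>"
  shows "y = \<one>"
proof -
  have L: "L y = 0" using L_pow[OF y, of k] k by simp
  let ?A = "(\<lambda>i::nat. y [^] i) ` {..<k}"
  obtain M where M: "\<forall>x\<in>?A. M \<preceq> x" "\<And>c. (\<forall>x\<in>?A. c \<preceq> x) \<Longrightarrow> c \<preceq> M"
    using finite_meet[of ?A] y k by blast
  have Mc: "M \<in> carrier G" using M(1) k le_closed by blast
  have "y \<otimes> M \<preceq> x" if "x \<in> ?A" for x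
  proof -
    \<comment> \<open>Exponent 0 is where the torsion hypothesis enters: the identity is
      \<open>y\<close> times the power with exponent \<open>k - 1\<close>.\<close>
    have "\<exists>i<k. x = y \<otimes> y [^] i"
    proof -
      obtain i where i: "i < k" "x = y [^] i" using \<open>x \<in> ?A\<close> by blast
      show ?thesis
      proof (cases i)
        case 0
        then show ?thesis using i k y nat_pow_Suc2[OF y, of "k - 1"] by (intro exI[of _ "k - 1"]) auto
      next
        case (Suc i')
        then show ?thesis using i y nat_pow_Suc2[OF y, of i'] by (intro exI[of _ i']) auto
      qed
    qed
    then show ?thesis using M(1) y Mc by auto
  qed
  then have "y \<otimes> M \<preceq> M" using M(2) by blast
  then have "y \<otimes> M = M" using le_L_eq y Mc L by (simp add: L_mult)
  then show ?thesis using y Mc by simp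
qed

text \<open>Weaker than centrality: conjugation may permute the atoms, as the half twist does with
  the generators. This is what survives when a central element is replaced by its meet with
  \<open>\<one>\<close>.\<close>

definition quasi_central :: "'a \<Rightarrow> bool" where
  "quasi_central p \<longleftrightarrow> p \<in> carrier G \<and> (\<forall>s\<in>S. inv p \<otimes> s \<otimes> p \<in> S)"

text \<open>Conjugation is injective, so it maps the finite set \<open>S\<close> onto itself, and
  the inverse conjugation preserves \<open>S\<close> too.\<close>

lemma quasi_central_inv:
  assumes "quasi_central p"
  shows "quasi_central (inv p)"
proof -
  have p: "p \<in> carrier G" using assms by (simp add: quasi_central_def)
  let ?c = "\<lambda>s. inv p \<otimes> s \<otimes> p"
  have "inj_on ?c S" by (rule inj_onI) (simp add: p m_assoc)
  moreover have "?c ` S \<subseteq> S" using assms by (auto simp: quasi_central_def)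
  ultimately have surj: "?c ` S = S" using S_finite endo_inj_surj by blast
  have "p \<otimes> s \<otimes> inv p \<in> S" if s: "s \<in> S" for s
  proof -
    obtain t where "t \<in> S" "s = ?c t" using surj s by blast
    then show ?thesis using p by (simp add: m_assoc)
  qed
  then show ?thesis using p by (simp add: quasi_central_def)
qed

text \<open>With \<open>M\<close> the meet of \<open>z\<close> and \<open>\<one>\<close>, both \<open>inv M \<otimes> z\<close> and \<open>inv M\<close> are positive and
  quasi-central, have the same length and no common divisor.\<close>

theorem central_length_zero:
  assumes z: "z \<in> carrier G" "\<And>x. x \<in> carrier G \<Longrightarrow> z \<otimes> x = x \<otimes> z" "L z = 0"
    and all: "\<And>p s. p \<in> P \<Longrightarrow> p \<noteq> \<one> \<Longrightarrow> quasi_central p \<Longrightarrow> s \<in> S \<Longrightarrow> s \<preceq> p"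
  shows "z = \<one>"
proof -
  obtain M where M: "M \<preceq> z" "M \<preceq> \<one>" "\<And>c. c \<preceq> z \<Longrightarrow> c \<preceq> \<one> \<Longrightarrow> c \<preceq> M"
    using meet[OF z(1) one_closed] by blast
  have Mc: "M \<in> carrier G" using M le_closed by blast
  have "inv M \<otimes> s \<otimes> M \<in> S" if s: "s \<in> S" for s
  proof (rule P_L_one)
    have sP: "s \<in> P" and sc: "s \<in> carrier G" using s S_subset_P by auto
    \<comment> \<open>Centrality of \<open>z\<close> puts \<open>M\<close> below
      \<open>s \<otimes> z\<close>. Hence \<open>inv s \<otimes> M\<close> is another common lower
      bound of \<open>z\<close> and \<open>\<one>\<close>; being below \<open>M\<close>, it makes
      the conjugate of \<open>s\<close> positive.\<close>
    have "M \<preceq> s \<otimes> z" using le_trans[OF M(1) le_mult_P[OF z(1) sP]] z(2)[OF sc] by simp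
    then have "inv s \<otimes> M \<preceq> inv s \<otimes> (s \<otimes> z)" using sc z(1) Mc by (simp del: mult_inv_cancel)
    moreover have "M \<preceq> s" using le_trans[OF M(2)] sP one_le_iff by blast
    then have "inv s \<otimes> M \<preceq> inv s \<otimes> s"
      using le_left_iff[of "inv s" M s] sc Mc by (simp only: inv_closed)
    ultimately have "inv s \<otimes> M \<preceq> M" using M(3) sc z by simp
    then have "s \<otimes> (inv s \<otimes> M) \<preceq> s \<otimes> M" using sc Mc by (simp del: mult_inv_cancel)
    then show "inv M \<otimes> s \<otimes> M \<in> P" using sc Mc by (simp add: le_def m_assoc)
    show "L (inv M \<otimes> s \<otimes> M) = 1" using s sc Mc by (simp add: L_mult L_inv L_S)
  qed
  then have "quasi_central M" using Mc by (simp add: quasi_central_def)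
  then have r: "quasi_central (inv M)" by (rule quasi_central_inv)
  \<comment> \<open>The central factor \<open>z\<close> does not affect conjugation, so
    \<open>inv M \<otimes> z\<close> acts on the atoms exactly as \<open>inv M\<close> does.\<close>
  have "inv (inv M \<otimes> z) \<otimes> s \<otimes> (inv M \<otimes> z) = M \<otimes> s \<otimes> inv M" if "s \<in> carrier G" for s
  proof -
    have "inv (inv M \<otimes> z) \<otimes> s \<otimes> (inv M \<otimes> z) = inv z \<otimes> ((M \<otimes> s \<otimes> inv M) \<otimes> z)"
      using that Mc z(1) by (simp add: inv_mult_group m_assoc)
    also have "\<dots> = inv z \<otimes> (z \<otimes> (M \<otimes> s \<otimes> inv M))"
      using that Mc z(2)[of "M \<otimes> s \<otimes> inv M"] by simp
    finally show ?thesis using that Mc z(1) by simp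
  qed
  then have p: "quasi_central (inv M \<otimes> z)" using r Mc z(1) by (simp add: quasi_central_def)
  have rP: "inv M \<in> P" "inv M \<otimes> z \<in> P" using M Mc by (auto simp: le_def)
  have "M = \<one>"
  proof (rule ccontr)
    assume ne: "M \<noteq> \<one>"
    then have ne': "inv M \<noteq> \<one>" using Mc by simp
    then have "L (inv M) \<noteq> 0" using P_L_zero rP by blast
    then have "L (inv M \<otimes> z) \<noteq> 0" using Mc z by (simp add: L_mult)
    then have ne2: "inv M \<otimes> z \<noteq> \<one>" by auto
    obtain s where s: "s \<in> S" using P_cases[OF rP(1)] ne' by blast
    have "s \<preceq> inv M" "s \<preceq> inv M \<otimes> z" using all rP ne' ne2 r p s by blast+
    \<comment> \<open>A common first atom \<open>s\<close> would give the common lower bound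
      \<open>M \<otimes> s\<close>, longer than the meet.\<close>
    then have "M \<otimes> s \<preceq> M" using M(3) Mc z(1) s by (simp add: le_shift)
    then have "L (M \<otimes> s) \<le> L M" by (rule le_L)
    then show False using s Mc by (simp add: L_mult L_S)
  qed
  then have "z \<in> P" using rP z(1) by simp
  then show ?thesis using P_L_zero z(3) by blast
qed

end

section \<open>The lattice order on the braid group\<close>

abbreviation braid_class :: "nat \<Rightarrow> braid_word \<Rightarrow> braid_word set" where
  "braid_class n w \<equiv> braid_cong n `` {w}"

lemma braid_class_eq_iff:
  "u \<in> braid_words n \<Longrightarrow> v \<in> braid_words n \<Longrightarrow>
    braid_class n u = braid_class n v \<longleftrightarrow> (u, v) \<in> braid_cong n"
  by (rule eq_equiv_class_iff[OF equiv_braid_cong])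

lemma braid_class_eqI: "(u, v) \<in> braid_cong n \<Longrightarrow> braid_class n u = braid_class n v"
  by (rule equiv_class_eq[OF equiv_braid_cong])

lemma braid_carrierE:
  assumes "x \<in> carrier (braid_group n)"
  obtains w where "w \<in> braid_words n" "x = braid_class n w"
  using assms by (auto simp: braid_group_def elim: quotientE)

lemma braid_class_Nil: "braid_class n [] = \<one>\<^bsub>braid_group n\<^esub>"
  by (simp add: braid_group_def)

text \<open>Choosing a representative turns a congruence invariant of words into a function of braids.\<close>

lemma some_representative:
  assumes "w \<in> braid_words n" "\<And>u v. (u, v) \<in> braid_cong n \<Longrightarrow> F u = F v"
  shows "F (SOME u. u \<in> braid_class n w) = F w"
proof -
  have "(SOME u. u \<in> braid_class n w) \<in> braid_class n w"
    by (rule someI[of _ w]) (simp add: assms(1) braid_cong.refl)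
  then have "(w, SOME u. u \<in> braid_class n w) \<in> braid_cong n" by simp
  then show ?thesis by (rule assms(2)[symmetric])
qed

fun exponent_sum :: "braid_word \<Rightarrow> int" where
  "exponent_sum [] = 0"
| "exponent_sum ((i, b) # w) = (if b then 1 else - 1) + exponent_sum w"

lemma exponent_sum_append [simp]: "exponent_sum (u @ v) = exponent_sum u + exponent_sum v"
  by (induction u rule: exponent_sum.induct) auto

lemma exponent_sum_cong: "(u, v) \<in> braid_cong n \<Longrightarrow> exponent_sum u = exponent_sum v"
  by (induction rule: braid_cong.induct) auto

lemma exponent_sum_pos_word [simp]: "exponent_sum (pos_word u) = int (length u)"
  by (induction u) auto

definition braid_length :: "braid_word set \<Rightarrow> int" where
  "braid_length x = exponent_sum (SOME u. u \<in> x)"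

lemma braid_length_class:
  "w \<in> braid_words n \<Longrightarrow> braid_length (braid_class n w) = exponent_sum w"
  unfolding braid_length_def by (rule some_representative) (auto intro: exponent_sum_cong)

definition pos_braid :: "nat \<Rightarrow> nat list \<Rightarrow> braid_word set" where
  "pos_braid n u = braid_class n (pos_word u)"

lemma pos_braid_closed [simp, intro]:
  "set u \<subseteq> {1..<n} \<Longrightarrow> pos_braid n u \<in> carrier (braid_group n)"
  unfolding pos_braid_def by (rule braid_class_in_carrier) (simp add: pos_word_in_braid_words)

lemma pos_braid_mult:
  "set u \<subseteq> {1..<n} \<Longrightarrow> set v \<subseteq> {1..<n} \<Longrightarrow>
    pos_braid n u \<otimes>\<^bsub>braid_group n\<^esub> pos_braid n v = pos_braid n (u @ v)"
  unfolding pos_braid_def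
  by (subst braid_class_mult) (simp_all add: pos_word_in_braid_words)

lemma pos_braid_Nil: "pos_braid n [] = \<one>\<^bsub>braid_group n\<^esub>"
  by (simp add: pos_braid_def braid_class_Nil)

lemma pos_braid_eq_iff:
  "set u \<subseteq> {1..<n} \<Longrightarrow> set v \<subseteq> {1..<n} \<Longrightarrow> pos_braid n u = pos_braid n v \<longleftrightarrow> u \<approx> v"
  by (simp add: pos_braid_def braid_class_eq_iff pos_word_in_braid_words pos_word_braid_cong_iff)

lemma pos_braid_length: "set u \<subseteq> {1..<n} \<Longrightarrow> braid_length (pos_braid n u) = int (length u)"
  by (simp add: pos_braid_def braid_length_class pos_word_in_braid_words)

section \<open>Positive braids as a Garside cone\<close>

definition pos_braids :: "nat \<Rightarrow> braid_word set set" where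
  "pos_braids n = pos_braid n ` {u. set u \<subseteq> {1..<n}}"

definition gen :: "nat \<Rightarrow> nat \<Rightarrow> braid_word set" where
  "gen n i = pos_braid n [i]"

definition twist :: "nat \<Rightarrow> braid_word set" where
  "twist n = pos_braid n (full_twist n)"

context
  fixes n :: nat
begin

interpretation group "braid_group n"
  by (rule group_braid_group)

lemma gen_closed [simp, intro]: "i \<in> {1..<n} \<Longrightarrow> gen n i \<in> carrier (braid_group n)"
  by (auto simp: gen_def)

lemma pos_braid_Cons:
  "i \<in> {1..<n} \<Longrightarrow> set u \<subseteq> {1..<n} \<Longrightarrow>
    pos_braid n (i # u) = gen n i \<otimes>\<^bsub>braid_group n\<^esub> pos_braid n u"
  using pos_braid_mult[of "[i]" n u] by (simp add: gen_def)

lemma braid_class_inverse_letter: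
  assumes "i \<in> {1..<n}"
  shows "braid_class n [(i, False)] = inv\<^bsub>braid_group n\<^esub> gen n i"
proof (rule inv_equality[symmetric])
  have w: "[(i, False)] \<in> braid_words n" "[(i, True)] \<in> braid_words n"
    using assms by (auto simp: braid_words_def)
  then show "braid_class n [(i, False)] \<in> carrier (braid_group n)"
    by (intro braid_class_in_carrier)
  show "gen n i \<in> carrier (braid_group n)" using assms by blast
  show "braid_class n [(i, False)] \<otimes>\<^bsub>braid_group n\<^esub> gen n i = \<one>\<^bsub>braid_group n\<^esub>"
    using w assms braid_class_eqI[OF braid_cong.cancel[of i n False]]
    by (simp add: gen_def pos_braid_def braid_class_mult braid_class_Nil)
qed

lemma braid_class_Cons:
  assumes "i \<in> {1..<n}" "w \<in> braid_words n"
  shows "braid_class n ((i, b) # w) =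
    (if b then gen n i else inv\<^bsub>braid_group n\<^esub> gen n i) \<otimes>\<^bsub>braid_group n\<^esub> braid_class n w"
proof -
  have "[(i, b)] \<in> braid_words n" using assms by (auto simp: braid_words_def)
  then have "braid_class n ((i, b) # w) = braid_class n [(i, b)] \<otimes>\<^bsub>braid_group n\<^esub> braid_class n w"
    using assms by (simp add: braid_class_mult)
  then show ?thesis using braid_class_inverse_letter[OF assms(1)]
    by (auto simp: gen_def pos_braid_def)
qed

lemma braid_induct [consumes 1, case_names one gen inv_gen]:
  assumes "x \<in> carrier (braid_group n)"
    and "Q \<one>\<^bsub>braid_group n\<^esub>"
    and "\<And>i x. i \<in> {1..<n} \<Longrightarrow> x \<in> carrier (braid_group n) \<Longrightarrow> Q x \<Longrightarrow>
      Q (gen n i \<otimes>\<^bsub>braid_group n\<^esub> x)"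
    and "\<And>i x. i \<in> {1..<n} \<Longrightarrow> x \<in> carrier (braid_group n) \<Longrightarrow> Q x \<Longrightarrow>
      Q (inv\<^bsub>braid_group n\<^esub> gen n i \<otimes>\<^bsub>braid_group n\<^esub> x)"
  shows "Q x"
proof -
  have "Q (braid_class n w)" if "w \<in> braid_words n" for w
    using that
  proof (induction w)
    case Nil
    then show ?case using assms(2) by (simp add: braid_class_Nil)
  next
    case (Cons a w)
    obtain i b where a: "a = (i, b)" by (cases a)
    have w: "i \<in> {1..<n}" "w \<in> braid_words n" using Cons.prems a by (auto simp: braid_words_def)
    have "Q (braid_class n w)" using Cons.IH w by blast
    then show ?case
      using assms(3,4)[OF w(1) braid_class_in_carrier[OF w(2)]]
      by (cases b) (simp_all add: a braid_class_Cons[OF w])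
  qed
  then show ?thesis using assms(1) by (auto elim: braid_carrierE)
qed

lemma commute_inv:
  assumes "x \<in> carrier (braid_group n)" "y \<in> carrier (braid_group n)"
    and "y \<otimes>\<^bsub>braid_group n\<^esub> x = x \<otimes>\<^bsub>braid_group n\<^esub> y"
  shows "y \<otimes>\<^bsub>braid_group n\<^esub> inv\<^bsub>braid_group n\<^esub> x = inv\<^bsub>braid_group n\<^esub> x \<otimes>\<^bsub>braid_group n\<^esub> y"
  using assms by (metis inv_closed inv_solve_left inv_solve_right m_assoc m_closed)

lemma braid_commute_gens:
  assumes y: "y \<in> carrier (braid_group n)"
    and c: "\<And>i. i \<in> {1..<n} \<Longrightarrow> y \<otimes>\<^bsub>braid_group n\<^esub> gen n i = gen n i \<otimes>\<^bsub>braid_group n\<^esub> y"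
    and x: "x \<in> carrier (braid_group n)"
  shows "y \<otimes>\<^bsub>braid_group n\<^esub> x = x \<otimes>\<^bsub>braid_group n\<^esub> y"
  using x
proof (induction rule: braid_induct)
  case one
  then show ?case using y by simp
next
  case (gen i x)
  then show ?case using y c[of i] by (metis gen_closed m_assoc)
next
  case (inv_gen i x)
  then show ?case using y commute_inv[OF _ y c, of i] by (metis gen_closed inv_closed m_assoc)
qed

lemma twist_closed [simp, intro]: "twist n \<in> carrier (braid_group n)"
  unfolding twist_def using set_full_twist by (rule pos_braid_closed)

lemma twist_central:
  assumes "x \<in> carrier (braid_group n)"
  shows "twist n \<otimes>\<^bsub>braid_group n\<^esub> x = x \<otimes>\<^bsub>braid_group n\<^esub> twist n"
proof (rule braid_commute_gens[OF _ _ assms])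
  fix i assume i: "i \<in> {1..<n}"
  then have "full_twist n @ [i] \<approx> [i] @ full_twist n"
    using full_twist_central_letter[of i n "[]"] by simp
  then show "twist n \<otimes>\<^bsub>braid_group n\<^esub> gen n i = gen n i \<otimes>\<^bsub>braid_group n\<^esub> twist n"
    using i set_full_twist[of n] by (simp add: twist_def gen_def pos_braid_mult pos_braid_eq_iff)
qed blast

lemma twist_inv_gen:
  assumes i: "i \<in> {1..<n}"
  shows "twist n \<otimes>\<^bsub>braid_group n\<^esub> inv\<^bsub>braid_group n\<^esub> gen n i = pos_braid n (twist_complement n i)"
proof -
  have "pos_braid n (twist_complement n i) \<otimes>\<^bsub>braid_group n\<^esub> gen n i = twist n"
    using i twist_complement_left[OF i] set_twist_complement[of n i] set_full_twist[of n]
    by (simp add: twist_def gen_def pos_braid_mult pos_braid_eq_iff)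
  then show ?thesis using i set_twist_complement[of n i] by (intro inv_solve_right'[THEN iffD2]) auto
qed

lemma twist_pow_positive:
  assumes "w \<in> braid_words n"
  shows "twist n [^]\<^bsub>braid_group n\<^esub> neg_count w \<otimes>\<^bsub>braid_group n\<^esub> braid_class n w
    = pos_braid n (positive_part n w)"
  using assms
proof (induction w)
  case Nil
  then show ?case by (simp add: braid_class_Nil pos_braid_Nil)
next
  case (Cons a w)
  obtain i b where a: "a = (i, b)" by (cases a)
  have w: "i \<in> {1..<n}" "w \<in> braid_words n" using Cons.prems a by (auto simp: braid_words_def)
  have wc: "braid_class n w \<in> carrier (braid_group n)" using w by (simp add: braid_class_in_carrier)
  have p: "set (positive_part n w) \<subseteq> {1..<n}" using w set_positive_part by blast
  let ?k = "neg_count w"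
  have comm: "twist n [^]\<^bsub>braid_group n\<^esub> ?k \<otimes>\<^bsub>braid_group n\<^esub> g
      = g \<otimes>\<^bsub>braid_group n\<^esub> twist n [^]\<^bsub>braid_group n\<^esub> ?k"
    if "g \<in> carrier (braid_group n)" for g
    using group_commutes_pow[of "twist n" g ?k] twist_central that by auto
  show ?case
  proof (cases b)
    case True
    have "twist n [^]\<^bsub>braid_group n\<^esub> ?k \<otimes>\<^bsub>braid_group n\<^esub> (gen n i \<otimes>\<^bsub>braid_group n\<^esub> braid_class n w)
      = gen n i \<otimes>\<^bsub>braid_group n\<^esub> (twist n [^]\<^bsub>braid_group n\<^esub> ?k \<otimes>\<^bsub>braid_group n\<^esub> braid_class n w)"
      using w wc comm[of "gen n i"] by (simp add: m_assoc[symmetric])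
    then show ?thesis using Cons.IH w p True
      by (simp add: a braid_class_Cons pos_braid_Cons)
  next
    case False
    let ?g = "inv\<^bsub>braid_group n\<^esub> gen n i"
    have g: "?g \<in> carrier (braid_group n)" using w by auto
    have "twist n [^]\<^bsub>braid_group n\<^esub> Suc ?k \<otimes>\<^bsub>braid_group n\<^esub> (?g \<otimes>\<^bsub>braid_group n\<^esub> braid_class n w)
      = twist n \<otimes>\<^bsub>braid_group n\<^esub> (twist n [^]\<^bsub>braid_group n\<^esub> ?k \<otimes>\<^bsub>braid_group n\<^esub> ?g) \<otimes>\<^bsub>braid_group n\<^esub> braid_class n w"
      using g wc by (simp only: nat_pow_Suc2 twist_closed) (simp add: m_assoc)
    also have "\<dots> = (twist n \<otimes>\<^bsub>braid_group n\<^esub> ?g) \<otimes>\<^bsub>braid_group n\<^esub>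
        (twist n [^]\<^bsub>braid_group n\<^esub> ?k \<otimes>\<^bsub>braid_group n\<^esub> braid_class n w)"
      using g wc comm[OF g] by (simp add: m_assoc)
    also have "\<dots> = pos_braid n (positive_part n (a # w))"
      using Cons.IH w p False set_twist_complement[of n i]
      by (simp add: a twist_inv_gen pos_braid_mult)
    finally show ?thesis using w False by (simp add: a braid_class_Cons)
  qed
qed

text \<open>The embedding of the positive monoid reduces divisibility in the group to divisibility
  of positive words.\<close>

lemma pos_braid_divides_iff:
  assumes u: "set u \<subseteq> {1..<n}" and v: "set v \<subseteq> {1..<n}"
  shows "inv\<^bsub>braid_group n\<^esub> pos_braid n u \<otimes>\<^bsub>braid_group n\<^esub> pos_braid n v \<in> pos_braids n
    \<longleftrightarrow> (\<exists>Z. set Z \<subseteq> {1..<n} \<and> v \<approx> u @ Z)"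
proof -
  have "inv\<^bsub>braid_group n\<^esub> pos_braid n u \<otimes>\<^bsub>braid_group n\<^esub> pos_braid n v = pos_braid n Z \<longleftrightarrow> v \<approx> u @ Z"
    if "set Z \<subseteq> {1..<n}" for Z
    using that u v pos_braid_eq_iff[of v n "u @ Z"]
      inv_solve_left'[of "pos_braid n Z" "pos_braid n u" "pos_braid n v"]
    by (simp add: pos_braid_mult)
  then show ?thesis by (auto simp: pos_braids_def)
qed

lemma complement_cong: "i # complement i j \<approx> j # complement j i"
  using index_cases[of i j]
  by (auto simp: far_sym adj_sym intro: pos_cong_far pos_cong_adj)

lemma set_complement: "set (complement i j) \<subseteq> {i, j}"
  by (auto simp: complement_def)

text \<open>Garside's lemma as minimality of the least common multiple. The cofactor
  \<open>Z\<close> stays within the generators because congruent words have the same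
  letters.\<close>

lemma gens_lcm:
  assumes i: "i \<in> {1..<n}" and j: "j \<in> {1..<n}"
    and X: "set X \<subseteq> {1..<n}" and Y: "set Y \<subseteq> {1..<n}" and c: "c \<approx> i # X" "c \<approx> j # Y"
  shows "\<exists>Z. set Z \<subseteq> {1..<n} \<and> c \<approx> (i # complement i j) @ Z"
proof -
  have "compat i X j Y" using c pos_cong_compat pos_cong_sym pos_cong_trans by blast
  then obtain Z where Z: "X \<approx> complement i j @ Z" by (auto simp: compat_def)
  have "c \<approx> (i # complement i j) @ Z" using c(1) pos_cong_Cons[OF Z, of i] pos_cong_trans by auto
  moreover have "set Z \<subseteq> {1..<n}" using pos_cong_length_set[OF Z] X by auto
  ultimately show ?thesis by blast
qed

lemma garside_cone_braid:
  "garside_cone (braid_group n) (pos_braids n) (gen n ` {1..<n}) braid_length (twist n)"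
proof unfold_locales
  show "gen n ` {1..<n} \<subseteq> carrier (braid_group n)" by auto
  show "\<one>\<^bsub>braid_group n\<^esub> \<in> pos_braids n"
    by (auto simp: pos_braids_def pos_braid_Nil[symmetric])
  show "pos_braids n \<subseteq> carrier (braid_group n)" by (auto simp: pos_braids_def)
  show "gen n ` {1..<n} \<subseteq> pos_braids n" by (auto simp: pos_braids_def gen_def)
  show "twist n \<in> pos_braids n" using set_full_twist by (auto simp: pos_braids_def twist_def)
  show "finite (gen n ` {1..<n})" by simp
next
  fix x y assume "x \<in> pos_braids n" "y \<in> pos_braids n"
  then show "x \<otimes>\<^bsub>braid_group n\<^esub> y \<in> pos_braids n"
    by (auto simp: pos_braids_def pos_braid_mult intro!: imageI)
next
  fix x assume "x \<in> pos_braids n"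
  then obtain u where u: "set u \<subseteq> {1..<n}" "x = pos_braid n u" by (auto simp: pos_braids_def)
  show "x = \<one>\<^bsub>braid_group n\<^esub> \<or>
      (\<exists>s\<in>gen n ` {1..<n}. \<exists>y\<in>pos_braids n. x = s \<otimes>\<^bsub>braid_group n\<^esub> y)"
  proof (cases u)
    case Nil
    then show ?thesis using u by (simp add: pos_braid_Nil)
  next
    case (Cons i v)
    then have "i \<in> {1..<n}" "set v \<subseteq> {1..<n}" using u by auto
    then have "gen n i \<in> gen n ` {1..<n}" "pos_braid n v \<in> pos_braids n"
      "x = gen n i \<otimes>\<^bsub>braid_group n\<^esub> pos_braid n v"
      using u Cons by (auto simp: pos_braids_def pos_braid_Cons)
    then show ?thesis by blast
  qed
  show "0 \<le> braid_length x" using u by (simp add: pos_braid_length)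
next
  fix x y assume "x \<in> carrier (braid_group n)" "y \<in> carrier (braid_group n)"
  then obtain u v where "u \<in> braid_words n" "v \<in> braid_words n"
    "x = braid_class n u" "y = braid_class n v" by (auto elim!: braid_carrierE)
  then show "braid_length (x \<otimes>\<^bsub>braid_group n\<^esub> y) = braid_length x + braid_length y"
    by (simp add: braid_class_mult braid_length_class[of _ n] braid_words_def)
next
  fix s assume "s \<in> gen n ` {1..<n}"
  then show "braid_length s = 1" by (auto simp: gen_def pos_braid_length)
next
  fix x assume "x \<in> carrier (braid_group n)"
  then show "twist n \<otimes>\<^bsub>braid_group n\<^esub> x = x \<otimes>\<^bsub>braid_group n\<^esub> twist n" by (rule twist_central)
next
  fix x assume "x \<in> carrier (braid_group n)"
  then obtain w where w: "w \<in> braid_words n" "x = braid_class n w" by (rule braid_carrierE)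
  then have "twist n [^]\<^bsub>braid_group n\<^esub> neg_count w \<otimes>\<^bsub>braid_group n\<^esub> x \<in> pos_braids n"
    using twist_pow_positive[OF w(1)] set_positive_part[OF w(1)] by (auto simp: pos_braids_def)
  then show "\<exists>k::nat. twist n [^]\<^bsub>braid_group n\<^esub> k \<otimes>\<^bsub>braid_group n\<^esub> x \<in> pos_braids n" by blast
next
  fix s t assume "s \<in> gen n ` {1..<n}" "t \<in> gen n ` {1..<n}"
  then obtain i j where ij: "i \<in> {1..<n}" "j \<in> {1..<n}" "s = pos_braid n [i]" "t = pos_braid n [j]"
    by (auto simp: gen_def)
  let ?u = "i # complement i j"
  have u: "set ?u \<subseteq> {1..<n}" "set (complement j i) \<subseteq> {1..<n}" "set (complement i j) \<subseteq> {1..<n}"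
    using ij set_complement[of i j] set_complement[of j i] by auto
  show "\<exists>c\<in>pos_braids n. inv\<^bsub>braid_group n\<^esub> s \<otimes>\<^bsub>braid_group n\<^esub> c \<in> pos_braids n \<and>
      inv\<^bsub>braid_group n\<^esub> t \<otimes>\<^bsub>braid_group n\<^esub> c \<in> pos_braids n \<and>
      (\<forall>d\<in>pos_braids n. inv\<^bsub>braid_group n\<^esub> s \<otimes>\<^bsub>braid_group n\<^esub> d \<in> pos_braids n \<longrightarrow>
        inv\<^bsub>braid_group n\<^esub> t \<otimes>\<^bsub>braid_group n\<^esub> d \<in> pos_braids n \<longrightarrow>
        inv\<^bsub>braid_group n\<^esub> c \<otimes>\<^bsub>braid_group n\<^esub> d \<in> pos_braids n)"
  proof (intro bexI[of _ "pos_braid n ?u"] conjI ballI impI)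
    show "inv\<^bsub>braid_group n\<^esub> s \<otimes>\<^bsub>braid_group n\<^esub> pos_braid n ?u \<in> pos_braids n"
      unfolding ij by (subst pos_braid_divides_iff) (use ij u in auto)
    show "inv\<^bsub>braid_group n\<^esub> t \<otimes>\<^bsub>braid_group n\<^esub> pos_braid n ?u \<in> pos_braids n"
      unfolding ij using complement_cong[of i j]
      by (subst pos_braid_divides_iff) (use ij u in auto)
    show "pos_braid n ?u \<in> pos_braids n" using u by (auto simp: pos_braids_def)
  next
    fix d assume d: "d \<in> pos_braids n"
      "inv\<^bsub>braid_group n\<^esub> s \<otimes>\<^bsub>braid_group n\<^esub> d \<in> pos_braids n"
      "inv\<^bsub>braid_group n\<^esub> t \<otimes>\<^bsub>braid_group n\<^esub> d \<in> pos_braids n"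
    obtain c where c: "set c \<subseteq> {1..<n}" "d = pos_braid n c" using d(1) by (auto simp: pos_braids_def)
    obtain X where X: "set X \<subseteq> {1..<n}" "c \<approx> i # X"
      using d(2) pos_braid_divides_iff[of "[i]" c] ij c by auto
    obtain Y where Y: "set Y \<subseteq> {1..<n}" "c \<approx> j # Y"
      using d(3) pos_braid_divides_iff[of "[j]" c] ij c by auto
    show "inv\<^bsub>braid_group n\<^esub> pos_braid n ?u \<otimes>\<^bsub>braid_group n\<^esub> d \<in> pos_braids n"
      using gens_lcm[OF ij(1,2) X(1) Y(1) X(2) Y(2)] pos_braid_divides_iff[OF u(1) c(1)] c(2) by blast
  qed
qed

end

context
  fixes n :: nat
begin

interpretation garside_cone "braid_group n" "pos_braids n" "gen n ` {1..<n}" braid_length "twist n"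
  by (rule garside_cone_braid)

abbreviation divides :: "braid_word set \<Rightarrow> braid_word set \<Rightarrow> bool" (infix \<open>\<preceq>\<close> 50) where
  "x \<preceq> y \<equiv> le x y"

text \<open>If \<open>\<sigma>\<^sub>i\<close> divides the quasi-central \<open>p\<close>, then the lcm \<open>\<sigma>\<^sub>j \<sigma>\<^sub>i \<sigma>\<^sub>j\<close> of \<open>\<sigma>\<^sub>i\<close> and \<open>\<sigma>\<^sub>j\<close> divides
  \<open>\<sigma>\<^sub>j p\<close>; so \<open>p = \<sigma>\<^sub>i \<sigma>\<^sub>j w\<close>, and conjugating by \<open>\<sigma>\<^sub>i\<close> shows that \<open>\<sigma>\<^sub>j\<close> divides \<open>p\<close>.\<close>

lemma quasi_central_divides_adj:
  assumes p: "p \<in> pos_braids n" "quasi_central p"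
    and i: "i \<in> {1..<n}" and j: "j \<in> {1..<n}" and ij: "adj i j" and le: "gen n i \<preceq> p"
  shows "gen n j \<preceq> p"
proof -
  let ?i = "gen n i" and ?j = "gen n j"
  have pc: "p \<in> carrier (braid_group n)" using p by blast
  have c: "?i \<in> carrier (braid_group n)" "?j \<in> carrier (braid_group n)" using i j by auto
  have conj: "inv\<^bsub>braid_group n\<^esub> p \<otimes>\<^bsub>braid_group n\<^esub> s \<otimes>\<^bsub>braid_group n\<^esub> p \<in> pos_braids n"
    if "s \<in> gen n ` {1..<n}" for s
    using p(2) that S_subset_P unfolding quasi_central_def by blast
  have jp: "?j \<otimes>\<^bsub>braid_group n\<^esub> p \<in> pos_braids n" using p j S_subset_P P_mult by blast
  \<comment> \<open>The quotient is the conjugate of \<open>\<sigma>\<^sub>j\<close> by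
    \<open>p\<close>, a generator and hence positive.\<close>
  have "p \<preceq> ?j \<otimes>\<^bsub>braid_group n\<^esub> p"
    using conj[of ?j] c pc j by (simp add: le_def m_assoc)
  then have 1: "?i \<preceq> ?j \<otimes>\<^bsub>braid_group n\<^esub> p" using le le_trans by blast
  have 2: "?j \<preceq> ?j \<otimes>\<^bsub>braid_group n\<^esub> p" using le_mult_P c p by blast
  obtain u where u: "set u \<subseteq> {1..<n}" "?j \<otimes>\<^bsub>braid_group n\<^esub> p = pos_braid n u"
    using jp by (auto simp: pos_braids_def)
  have div: "pos_braid n v \<preceq> pos_braid n u \<longleftrightarrow> (\<exists>Z. set Z \<subseteq> {1..<n} \<and> u \<approx> v @ Z)"
    if "set v \<subseteq> {1..<n}" for v
    using pos_braid_divides_iff[OF that u(1)] that u(1) by (simp add: le_def)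
  obtain X where X: "set X \<subseteq> {1..<n}" "u \<approx> i # X"
    using 1 div[of "[i]"] i u(2) by (auto simp: gen_def)
  obtain Y where Y: "set Y \<subseteq> {1..<n}" "u \<approx> j # Y"
    using 2 div[of "[j]"] j u(2) by (auto simp: gen_def)
  have "pos_braid n [j, i, j] \<preceq> ?j \<otimes>\<^bsub>braid_group n\<^esub> p"
    using gens_lcm[OF j i Y(1) X(1) Y(2) X(2)] div[of "[j, i, j]"] adj_sym[OF ij] i j u(2) by simp
  moreover have "pos_braid n [j, i, j] = ?j \<otimes>\<^bsub>braid_group n\<^esub> (?i \<otimes>\<^bsub>braid_group n\<^esub> ?j)"
    using i j by (simp add: pos_braid_Cons[of j n] pos_braid_Cons[of i n] pos_braid_Nil)
  ultimately have "?i \<otimes>\<^bsub>braid_group n\<^esub> ?j \<preceq> p" using c pc by simp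
  then obtain w where w: "w \<in> pos_braids n" "p = ?i \<otimes>\<^bsub>braid_group n\<^esub> ?j \<otimes>\<^bsub>braid_group n\<^esub> w"
    by (rule leE)
  let ?s = "inv\<^bsub>braid_group n\<^esub> p \<otimes>\<^bsub>braid_group n\<^esub> ?i \<otimes>\<^bsub>braid_group n\<^esub> p"
  have s: "?s \<in> pos_braids n" using conj i by blast
  \<comment> \<open>As \<open>\<sigma>\<^sub>i p = p ?s\<close>, one has
    \<open>p = \<sigma>\<^sub>i\<^sup>-\<^sup>1 p ?s\<close>. Removing
    \<open>\<sigma>\<^sub>j\<close> from the left of this expression leaves the positive braid
    \<open>w ?s\<close>.\<close>
  have "inv\<^bsub>braid_group n\<^esub> ?j \<otimes>\<^bsub>braid_group n\<^esub> p
      = inv\<^bsub>braid_group n\<^esub> ?j \<otimes>\<^bsub>braid_group n\<^esub> (inv\<^bsub>braid_group n\<^esub> ?i \<otimes>\<^bsub>braid_group n\<^esub> p) \<otimes>\<^bsub>braid_group n\<^esub> ?s"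
    using c pc by (simp add: m_assoc)
  also have "inv\<^bsub>braid_group n\<^esub> ?j \<otimes>\<^bsub>braid_group n\<^esub> (inv\<^bsub>braid_group n\<^esub> ?i \<otimes>\<^bsub>braid_group n\<^esub> p) = w"
    using c w(1) by (simp add: w(2) m_assoc)
  finally have "inv\<^bsub>braid_group n\<^esub> ?j \<otimes>\<^bsub>braid_group n\<^esub> p \<in> pos_braids n"
    using P_mult[OF w(1) s] by simp
  then show ?thesis using c pc by (simp add: le_def)
qed

text \<open>A nontrivial positive braid has some first generator; divisibility then spreads from
  index to neighbouring index, upwards or downwards to \<open>j\<close>.\<close>

lemma quasi_central_divides:
  assumes p: "p \<in> pos_braids n" "quasi_central p" "p \<noteq> \<one>\<^bsub>braid_group n\<^esub>"
    and j: "j \<in> {1..<n}"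
  shows "gen n j \<preceq> p"
proof -
  obtain i y where i: "i \<in> {1..<n}" "y \<in> pos_braids n" "p = gen n i \<otimes>\<^bsub>braid_group n\<^esub> y"
    using P_cases p by blast
  then have le: "gen n i \<preceq> p" by (simp add: le_mult_P)
  show ?thesis
  proof (cases "i \<le> j")
    case True
    then show ?thesis using j
    proof (induction j rule: dec_induct)
      case (step k)
      then show ?case using quasi_central_divides_adj[OF p(1,2), of k "Suc k"] i(1)
        by (simp add: adj_def)
    qed (rule le)
  next
    case False
    then have "j \<le> i" by simp
    then show ?thesis using j
    proof (induction j rule: inc_induct)
      case (step k)
      then show ?case using quasi_central_divides_adj[OF p(1,2), of "Suc k" k] i(1)
        by (simp add: adj_def)
    qed (rule le)
  qed
qed

section \<open>Torsion-freeness and periodic braids as roots of twist powers\<close>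

lemma braid_torsion_free:
  "y \<in> carrier (braid_group n) \<Longrightarrow> 0 < k \<Longrightarrow> y [^]\<^bsub>braid_group n\<^esub> (k::nat) = \<one>\<^bsub>braid_group n\<^esub> \<Longrightarrow>
    y = \<one>\<^bsub>braid_group n\<^esub>"
  by (rule torsion_free)

lemma braid_center_length_zero:
  assumes "z \<in> group_center (braid_group n)" "braid_length z = 0"
  shows "z = \<one>\<^bsub>braid_group n\<^esub>"
proof (rule central_length_zero)
  fix p s
  assume "p \<in> pos_braids n" "p \<noteq> \<one>\<^bsub>braid_group n\<^esub>" "quasi_central p" "s \<in> gen n ` {1..<n}"
  then show "s \<preceq> p" using quasi_central_divides by blast
qed (use assms in \<open>auto simp: group_center_def\<close>)

lemma twist_length: "braid_length (twist n) = int (n * (n - 1))"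
  using set_full_twist[of n]
  by (simp add: twist_def pos_braid_length full_twist_def word_power_def length_concat
      sum_list_replicate rotation_def)

lemma twist_int_pow_central:
  "x \<in> carrier (braid_group n) \<Longrightarrow>
    twist n [^]\<^bsub>braid_group n\<^esub> (e::int) \<otimes>\<^bsub>braid_group n\<^esub> x
      = x \<otimes>\<^bsub>braid_group n\<^esub> twist n [^]\<^bsub>braid_group n\<^esub> e"
proof -
  assume x: "x \<in> carrier (braid_group n)"
  have nat: "twist n [^]\<^bsub>braid_group n\<^esub> k \<otimes>\<^bsub>braid_group n\<^esub> x
      = x \<otimes>\<^bsub>braid_group n\<^esub> twist n [^]\<^bsub>braid_group n\<^esub> k" for k :: nat
    using group_commutes_pow[of "twist n" x k] twist_central x by auto
  then show ?thesis
    using x commute_inv[of "twist n [^]\<^bsub>braid_group n\<^esub> k" n x for k :: nat]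
    by (cases e rule: int_cases2) (simp_all add: int_pow_int int_pow_neg_int)
qed

text \<open>Let \<open>z\<close> be a central power of \<open>x\<close>, of length \<open>e\<close>,
  and let \<open>l\<close> be the length of the twist. Then \<open>z\<close> to the power
  \<open>l\<close> and the twist to the power \<open>e\<close> are central of equal length, hence
  equal. The bound \<open>2 \<le> n\<close> makes \<open>l\<close> positive.\<close>

lemma periodic_twist_power:
  assumes x: "periodic_braid n x" and n: "2 \<le> n"
  obtains k :: nat and e :: int where "0 < k"
    "x [^]\<^bsub>braid_group n\<^esub> k = twist n [^]\<^bsub>braid_group n\<^esub> e"
proof -
  obtain k :: nat where k: "0 < k" "x [^]\<^bsub>braid_group n\<^esub> k \<in> group_center (braid_group n)"
    and xc: "x \<in> carrier (braid_group n)"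
    using x by (auto simp: periodic_braid_def)
  define l where "l = n * (n - 1)"
  define z where "z = x [^]\<^bsub>braid_group n\<^esub> k"
  define e where "e = braid_length z"
  have zc: "z \<in> carrier (braid_group n)" using xc z_def by simp
  have z: "z \<otimes>\<^bsub>braid_group n\<^esub> y = y \<otimes>\<^bsub>braid_group n\<^esub> z" if "y \<in> carrier (braid_group n)" for y
    using k(2) that by (auto simp: group_center_def z_def)
  have zl: "z [^]\<^bsub>braid_group n\<^esub> l \<otimes>\<^bsub>braid_group n\<^esub> y = y \<otimes>\<^bsub>braid_group n\<^esub> z [^]\<^bsub>braid_group n\<^esub> l"
    if "y \<in> carrier (braid_group n)" for y
    using group_commutes_pow[of z y l] z zc that by auto
  let ?y = "z [^]\<^bsub>braid_group n\<^esub> l \<otimes>\<^bsub>braid_group n\<^esub> twist n [^]\<^bsub>braid_group n\<^esub> (- e)"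
  have Lpow: "braid_length (twist n [^]\<^bsub>braid_group n\<^esub> a) = a * int l" for a :: int
    by (cases a rule: int_cases2)
      (simp_all add: int_pow_int int_pow_neg_int L_pow L_inv twist_length l_def)
  have "?y = \<one>\<^bsub>braid_group n\<^esub>"
  proof (rule braid_center_length_zero)
    show "braid_length ?y = 0" using zc by (simp add: L_mult L_pow Lpow e_def)
    have "?y \<otimes>\<^bsub>braid_group n\<^esub> g = g \<otimes>\<^bsub>braid_group n\<^esub> ?y" if g: "g \<in> carrier (braid_group n)" for g
    proof -
      have "?y \<otimes>\<^bsub>braid_group n\<^esub> g
          = z [^]\<^bsub>braid_group n\<^esub> l \<otimes>\<^bsub>braid_group n\<^esub> g \<otimes>\<^bsub>braid_group n\<^esub> twist n [^]\<^bsub>braid_group n\<^esub> (- e)"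
        using g zc twist_int_pow_central[OF g, of "- e"] by (simp add: m_assoc)
      then show ?thesis using g zc zl[OF g] by (simp add: m_assoc)
    qed
    then show "?y \<in> group_center (braid_group n)" using zc by (simp add: group_center_def)
  qed
  then have "z [^]\<^bsub>braid_group n\<^esub> l = twist n [^]\<^bsub>braid_group n\<^esub> e"
    using zc inv_equality[of "z [^]\<^bsub>braid_group n\<^esub> l" "twist n [^]\<^bsub>braid_group n\<^esub> (- e)"]
    by (simp add: int_pow_neg)
  then have "x [^]\<^bsub>braid_group n\<^esub> (k * l) = twist n [^]\<^bsub>braid_group n\<^esub> e"
    using xc by (simp add: z_def nat_pow_pow)
  moreover have "0 < k * l" using k n by (simp add: l_def)
  ultimately show ?thesis using that by blast
qed

end

section \<open>Winding numbers and periodic braids\<close>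

fun strand_end :: "braid_word \<Rightarrow> nat \<Rightarrow> nat" where
  "strand_end [] i = i"
| "strand_end ((k, b) # w) i = strand_end w (transpose k (Suc k) i)"

text \<open>Positive crossings are counted when the first strand passes from left to right, negative
  ones when it passes back; so two strands of a full twist have winding number 1, not 2.\<close>

fun winding :: "braid_word \<Rightarrow> nat \<Rightarrow> nat \<Rightarrow> int" where
  "winding [] i j = 0"
| "winding ((k, b) # w) i j =
    (if b then of_bool (i = k \<and> j = Suc k) else - of_bool (i = Suc k \<and> j = k))
      + winding w (transpose k (Suc k) i) (transpose k (Suc k) j)"

lemma strand_end_append: "strand_end (u @ v) = strand_end v \<circ> strand_end u"
proof
  show "strand_end (u @ v) i = (strand_end v \<circ> strand_end u) i" for i
    by (induction u i rule: strand_end.induct) auto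
qed

lemma winding_append:
  "winding (u @ v) i j = winding u i j + winding v (strand_end u i) (strand_end u j)"
  by (induction u i j rule: winding.induct) auto

lemma strand_end_cong: "(u, v) \<in> braid_cong n \<Longrightarrow> strand_end u = strand_end v"
proof (induction rule: braid_cong.induct)
  case (cancel i b)
  then show ?case by (auto simp: fun_eq_iff)
next
  case (far i j)
  then show ?case by (auto simp: fun_eq_iff transpose_def)
next
  case (braid i)
  then show ?case by (auto simp: fun_eq_iff transpose_def)
qed (simp_all add: strand_end_append)

lemma winding_cong: "(u, v) \<in> braid_cong n \<Longrightarrow> winding u = winding v"
proof (induction rule: braid_cong.induct)
  case (append u u' v v')
  then show ?case by (simp add: fun_eq_iff winding_append strand_end_cong[OF append(1)])
next
  case (cancel i b)
  then show ?case by (auto simp: fun_eq_iff transpose_def)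
next
  case (far i j)
  then show ?case by (auto simp: fun_eq_iff transpose_def)
next
  case (braid i)
  then show ?case by (auto simp: fun_eq_iff transpose_def)
qed simp_all

lemma strand_end_permutes: "w \<in> braid_words n \<Longrightarrow> strand_end w permutes {1..n}"
proof (induction w)
  case (Cons a w)
  obtain k b where a: "a = (k, b)" by (cases a)
  have w: "k \<in> {1..<n}" "w \<in> braid_words n" using Cons.prems a by (auto simp: braid_words_def)
  have "strand_end (a # w) = strand_end w \<circ> transpose k (Suc k)" by (auto simp: a)
  moreover have "transpose k (Suc k) permutes {1..n}" using w by (intro permutes_swap_id) auto
  ultimately show ?case using Cons.IH w permutes_compose by metis
qed (simp add: permutes_def)

section \<open>Winding numbers of rotations\<close>

lemma strand_end_upt:
  "a \<le> b \<Longrightarrow> strand_end (pos_word [a..<b]) i =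
    (if i = a then b else if a < i \<and> i \<le> b then i - 1 else i)"
  by (induction b rule: dec_induct)
    (auto simp: strand_end_append transpose_def)

text \<open>Only the strand starting at \<open>a\<close> moves to the right, crossing each strand up
  to \<open>b\<close> once.\<close>

lemma winding_upt:
  "a \<le> b \<Longrightarrow> i \<noteq> j \<Longrightarrow> winding (pos_word [a..<b]) i j = of_bool (i = a \<and> a < j \<and> j \<le> b)"
proof (induction b rule: dec_induct)
  case (step b)
  have "winding (pos_word [a..<Suc b]) i j = of_bool (i = a \<and> a < j \<and> j \<le> b) +
      of_bool (strand_end (pos_word [a..<b]) i = b \<and> strand_end (pos_word [a..<b]) j = Suc b)"
    using step by (simp add: winding_append)
  then show ?case using step by (auto simp: strand_end_upt split: if_splits)
qed auto

lemma strand_end_rotation_power: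
  "l \<le> n \<Longrightarrow> i \<in> {1..n} \<Longrightarrow> strand_end (pos_word (word_power l (rotation n))) i =
    (if l < i then i - l else i + n - l)"
proof (induction l arbitrary: i)
  case (Suc l)
  have "strand_end (pos_word (rotation n)) i = (if i = 1 then n else i - 1)"
    using Suc.prems by (auto simp: rotation_def strand_end_upt)
  moreover have "strand_end (pos_word (word_power l (rotation n))) (if i = 1 then n else i - 1) =
      (if l < (if i = 1 then n else i - 1) then (if i = 1 then n else i - 1) - l
       else (if i = 1 then n else i - 1) + n - l)"
    using Suc.prems by (intro Suc.IH) auto
  ultimately show ?case using Suc.prems by (auto simp: strand_end_append)
qed simp

text \<open>Each rotation takes the leftmost strand across all the others, so the first
  \<open>l\<close> rotations do this to strands 1 to \<open>l\<close> in turn. The value does not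
  depend on \<open>j\<close>.\<close>

lemma winding_rotation_power:
  "l \<le> n \<Longrightarrow> i \<in> {1..n} \<Longrightarrow> j \<in> {1..n} \<Longrightarrow> i \<noteq> j \<Longrightarrow>
    winding (pos_word (word_power l (rotation n))) i j = of_bool (i \<le> l)"
proof (induction l arbitrary: i j)
  case (Suc l)
  have se: "strand_end (pos_word (rotation n)) i = (if i = 1 then n else i - 1)"
      "strand_end (pos_word (rotation n)) j = (if j = 1 then n else j - 1)"
    using Suc.prems by (auto simp: rotation_def strand_end_upt)
  have w: "winding (pos_word (rotation n)) i j = of_bool (i = 1)"
    using Suc.prems by (auto simp: rotation_def winding_upt)
  have "winding (pos_word (word_power l (rotation n)))
      (if i = 1 then n else i - 1) (if j = 1 then n else j - 1)
      = of_bool ((if i = 1 then n else i - 1) \<le> l)"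
    using Suc.prems by (intro Suc.IH) auto
  then show ?case using Suc.prems by (auto simp: winding_append se w)
qed simp

section \<open>Permutations and winding numbers of braids\<close>

definition braid_perm :: "braid_word set \<Rightarrow> nat \<Rightarrow> nat" where
  "braid_perm x = strand_end (SOME w. w \<in> x)"

definition braid_winding :: "braid_word set \<Rightarrow> nat \<Rightarrow> nat \<Rightarrow> int" where
  "braid_winding x = winding (SOME w. w \<in> x)"

lemma braid_perm_class: "w \<in> braid_words n \<Longrightarrow> braid_perm (braid_class n w) = strand_end w"
  unfolding braid_perm_def by (rule some_representative[OF _ strand_end_cong])

lemma braid_winding_class: "w \<in> braid_words n \<Longrightarrow> braid_winding (braid_class n w) = winding w"
  unfolding braid_winding_def by (rule some_representative[OF _ winding_cong])

context
  fixes n :: nat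
begin

interpretation group "braid_group n"
  by (rule group_braid_group)

text \<open>Words are read from left to right, so the permutation is an antihomomorphism, and
  winding numbers form a cocycle for its action on pairs.\<close>

lemma braid_perm_winding_mult:
  assumes "x \<in> carrier (braid_group n)" "y \<in> carrier (braid_group n)"
  shows "braid_perm (x \<otimes>\<^bsub>braid_group n\<^esub> y) = braid_perm y \<circ> braid_perm x"
    and "braid_winding (x \<otimes>\<^bsub>braid_group n\<^esub> y) i j =
      braid_winding x i j + braid_winding y (braid_perm x i) (braid_perm x j)"
proof -
  obtain u v where w: "u \<in> braid_words n" "v \<in> braid_words n"
    and xy: "x = braid_class n u" "y = braid_class n v" using assms by (auto elim!: braid_carrierE)
  have uv: "u @ v \<in> braid_words n" using w by (auto simp: braid_words_def)
  show "braid_perm (x \<otimes>\<^bsub>braid_group n\<^esub> y) = braid_perm y \<circ> braid_perm x"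
    using w uv by (simp add: xy braid_class_mult braid_perm_class strand_end_append)
  show "braid_winding (x \<otimes>\<^bsub>braid_group n\<^esub> y) i j =
      braid_winding x i j + braid_winding y (braid_perm x i) (braid_perm x j)"
    using w uv
    by (simp add: xy braid_class_mult braid_perm_class braid_winding_class winding_append)
qed

lemma braid_perm_winding_one:
  "braid_perm \<one>\<^bsub>braid_group n\<^esub> = id" "braid_winding \<one>\<^bsub>braid_group n\<^esub> i j = 0"
proof -
  have "[] \<in> braid_words n" by (simp add: braid_words_def)
  then show "braid_perm \<one>\<^bsub>braid_group n\<^esub> = id" "braid_winding \<one>\<^bsub>braid_group n\<^esub> i j = 0"
    using braid_perm_class[of "[]" n] braid_winding_class[of "[]" n]
    by (auto simp: braid_class_Nil)
qed

lemma braid_perm_permutes: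
  "x \<in> carrier (braid_group n) \<Longrightarrow> braid_perm x permutes {1..n}"
  by (erule braid_carrierE) (simp add: braid_perm_class strand_end_permutes del: One_nat_def)

lemma braid_perm_pow:
  "x \<in> carrier (braid_group n) \<Longrightarrow> braid_perm (x [^]\<^bsub>braid_group n\<^esub> (k::nat)) = braid_perm x ^^ k"
  by (induction k) (simp_all add: braid_perm_winding_one braid_perm_winding_mult(1))

lemma braid_winding_pow:
  "x \<in> carrier (braid_group n) \<Longrightarrow> braid_winding (x [^]\<^bsub>braid_group n\<^esub> (k::nat)) i j =
    (\<Sum>l<k. braid_winding x ((braid_perm x ^^ l) i) ((braid_perm x ^^ l) j))"
  by (induction k)
    (simp_all add: braid_perm_winding_one braid_perm_winding_mult(2) braid_perm_pow)

lemma twist_perm: "braid_perm (twist n) = id"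
proof
  have w: "pos_word (full_twist n) \<in> braid_words n"
    using set_full_twist by (simp add: pos_word_in_braid_words)
  fix i
  show "braid_perm (twist n) i = id i"
  proof (cases "i \<in> {1..n}")
    case True
    then show ?thesis using strand_end_rotation_power[of n n i] w
      by (simp add: twist_def pos_braid_def braid_perm_class full_twist_def)
  next
    case False
    then show ?thesis using permutes_not_in[OF braid_perm_permutes[OF twist_closed]] by simp
  qed
qed

lemma twist_winding:
  "i \<in> {1..n} \<Longrightarrow> j \<in> {1..n} \<Longrightarrow> i \<noteq> j \<Longrightarrow> braid_winding (twist n) i j = 1"
  using winding_rotation_power[of n n i j] set_full_twist[of n]
  by (simp add: twist_def pos_braid_def braid_winding_class pos_word_in_braid_words full_twist_def)

lemma twist_int_pow_winding:
  assumes "i \<in> {1..n}" "j \<in> {1..n}" "i \<noteq> j"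
  shows "braid_winding (twist n [^]\<^bsub>braid_group n\<^esub> (e::int)) i j = e"
proof -
  have nat: "braid_winding (twist n [^]\<^bsub>braid_group n\<^esub> k) i j = int k"
      "braid_perm (twist n [^]\<^bsub>braid_group n\<^esub> k) = id" for k :: nat
    using assms by (simp_all add: braid_winding_pow braid_perm_pow twist_perm twist_winding)
  have "braid_winding (inv\<^bsub>braid_group n\<^esub> (twist n [^]\<^bsub>braid_group n\<^esub> k)) i j = - int k" for k :: nat
    using braid_perm_winding_mult(2)[of "twist n [^]\<^bsub>braid_group n\<^esub> k"
        "inv\<^bsub>braid_group n\<^esub> (twist n [^]\<^bsub>braid_group n\<^esub> k)" i j]
    by (simp add: nat braid_perm_winding_one)
  then show ?thesis
    by (cases e rule: int_cases2) (simp_all add: int_pow_int int_pow_neg_int nat)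
qed

text \<open>The winding number of a power is a sum along the orbit of the pair. As \<open>p\<close>
  commutes with the permutation, the orbit of \<open>(p i, i)\<close> consists of pairs of the same
  form; as \<open>A\<close> is permuted, each of the \<open>k\<close> factors contributes the same
  sum over \<open>A\<close>.\<close>

lemma sum_braid_winding_pow:
  assumes x: "x \<in> carrier (braid_group n)" and h: "\<And>i. i \<in> {1..n} \<Longrightarrow> p (braid_perm x i) = braid_perm x (p i)"
    and A: "A \<subseteq> {1..n}" "braid_perm x permutes A"
  shows "(\<Sum>i\<in>A. braid_winding (x [^]\<^bsub>braid_group n\<^esub> (k::nat)) (p i) i)
    = int k * (\<Sum>i\<in>A. braid_winding x (p i) i)"
proof -
  let ?f = "braid_perm x"
  have pl: "(?f ^^ l) permutes A" for l
  proof (induction l)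
    case (Suc l)
    then show ?case using permutes_compose[OF Suc A(2)] by (simp add: o_def)
  qed (simp add: permutes_def)
  have comm: "(?f ^^ l) (p i) = p ((?f ^^ l) i)" if "i \<in> A" for i l
  proof (induction l)
    case (Suc l)
    have "(?f ^^ l) i \<in> {1..n}" using that A(1) permutes_in_image[OF pl, of l i] by blast
    then show ?case using Suc h by simp
  qed simp
  have "(\<Sum>i\<in>A. braid_winding (x [^]\<^bsub>braid_group n\<^esub> k) (p i) i)
      = (\<Sum>l<k. \<Sum>i\<in>A. braid_winding x (p ((?f ^^ l) i)) ((?f ^^ l) i))"
    by (simp add: braid_winding_pow[OF x] comm sum.swap[of _ A])
  also have "\<dots> = (\<Sum>l<k. \<Sum>i\<in>A. braid_winding x (p i) i)"
    using sum.permute[OF pl, of "\<lambda>i. braid_winding x (p i) i"] by (simp add: o_def)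
  finally show ?thesis by simp
qed

text \<open>If the permutation of \<open>x\<close> has no fixed point, sum the winding numbers of \<open>(\<pi> i, i)\<close> over
  all \<open>i\<close>; if it fixes \<open>p\<close>, sum those of \<open>(p, i)\<close> over all \<open>i \<noteq> p\<close>.\<close>

lemma twist_exponent_dvd:
  assumes x: "x \<in> carrier (braid_group n)"
    and k: "x [^]\<^bsub>braid_group n\<^esub> (k::nat) = twist n [^]\<^bsub>braid_group n\<^esub> (e::int)"
  shows "\<exists>j\<in>{n, n - 1}. int k dvd int j * e"
proof (cases "\<exists>p\<in>{1..n}. braid_perm x p = p")
  case True
  then obtain p where p: "p \<in> {1..n}" "braid_perm x p = p" by blast
  have perm: "braid_perm x permutes ({1..n} - {p})"
    using p(2) by (intro permutes_superset[OF braid_perm_permutes[OF x]]) auto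
  have "braid_winding (x [^]\<^bsub>braid_group n\<^esub> k) p i = e" if "i \<in> {1..n} - {p}" for i
    unfolding k by (rule twist_int_pow_winding) (use p that in auto)
  then have "(\<Sum>i\<in>{1..n} - {p}. braid_winding (x [^]\<^bsub>braid_group n\<^esub> k) p i) = (\<Sum>i\<in>{1..n} - {p}. e)"
    by (intro sum.cong) simp_all
  also have "\<dots> = int (n - 1) * e" using p by simp
  finally have "int (n - 1) * e = int k * (\<Sum>i\<in>{1..n} - {p}. braid_winding x p i)"
    using sum_braid_winding_pow[OF x, of "\<lambda>_. p" "{1..n} - {p}" k] p perm by simp
  then show ?thesis by auto
next
  case False
  let ?f = "braid_perm x"
  have perm: "?f permutes {1..n}" using braid_perm_permutes[OF x] .
  have "braid_winding (x [^]\<^bsub>braid_group n\<^esub> k) (?f i) i = e" if "i \<in> {1..n}" for i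
    unfolding k
    by (rule twist_int_pow_winding) (use False that permutes_in_image[OF perm] in auto)
  then have "(\<Sum>i\<in>{1..n}. braid_winding (x [^]\<^bsub>braid_group n\<^esub> k) (?f i) i) = (\<Sum>i\<in>{1..n}. e)"
    by (intro sum.cong) simp_all
  then have "int n * e = int k * (\<Sum>i\<in>{1..n}. braid_winding x (?f i) i)"
    using sum_braid_winding_pow[OF x, of ?f "{1..n}" k] perm by simp
  then show ?thesis by auto
qed

theorem periodic_power_central:
  assumes x: "periodic_braid n x" and n: "2 \<le> n"
  shows "\<exists>j\<in>{n, n - 1}. x [^]\<^bsub>braid_group n\<^esub> j \<in> group_center (braid_group n)"
proof -
  have xc: "x \<in> carrier (braid_group n)" using x by (simp add: periodic_braid_def)
  obtain k :: nat and e :: int where k: "0 < k"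
    "x [^]\<^bsub>braid_group n\<^esub> k = twist n [^]\<^bsub>braid_group n\<^esub> e"
    using periodic_twist_power[OF x n] .
  obtain j where j: "j \<in> {n, n - 1}" "int k dvd int j * e" using twist_exponent_dvd[OF xc k(2)] by blast
  then obtain s where s: "int j * e = int k * s" by (auto elim: dvdE)
  let ?t = "twist n [^]\<^bsub>braid_group n\<^esub> (- s)"
  \<comment> \<open>The \<open>k\<close>-th power of \<open>?y\<close> is a twist power with
    exponent \<open>e j - s k = 0\<close>, so \<open>?y\<close> is torsion.\<close>
  let ?y = "x [^]\<^bsub>braid_group n\<^esub> j \<otimes>\<^bsub>braid_group n\<^esub> ?t"
  have "?y [^]\<^bsub>braid_group n\<^esub> k
      = (x [^]\<^bsub>braid_group n\<^esub> j) [^]\<^bsub>braid_group n\<^esub> k \<otimes>\<^bsub>braid_group n\<^esub> ?t [^]\<^bsub>braid_group n\<^esub> k"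
    using xc twist_int_pow_central[of "x [^]\<^bsub>braid_group n\<^esub> j" n "- s"]
    by (intro pow_mult_distrib) simp_all
  also have "(x [^]\<^bsub>braid_group n\<^esub> j) [^]\<^bsub>braid_group n\<^esub> k
      = (x [^]\<^bsub>braid_group n\<^esub> k) [^]\<^bsub>braid_group n\<^esub> j"
    using xc by (simp add: nat_pow_pow mult.commute)
  also have "\<dots> = twist n [^]\<^bsub>braid_group n\<^esub> (e * int j)"
    using k(2) int_pow_pow[OF twist_closed, of e "int j"] by (simp add: int_pow_int)
  also have "?t [^]\<^bsub>braid_group n\<^esub> k = twist n [^]\<^bsub>braid_group n\<^esub> (- s * int k)"
    using int_pow_pow[OF twist_closed, of "- s" "int k"] by (simp add: int_pow_int)
  also have "twist n [^]\<^bsub>braid_group n\<^esub> (e * int j) \<otimes>\<^bsub>braid_group n\<^esub> twist n [^]\<^bsub>braid_group n\<^esub> (- s * int k)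
      = \<one>\<^bsub>braid_group n\<^esub>"
    using int_pow_mult[OF twist_closed, of "e * int j" "- s * int k"] s by (simp add: mult.commute)
  finally have "?y = \<one>\<^bsub>braid_group n\<^esub>"
    using braid_torsion_free[OF _ k(1)] xc by simp
  then have "x [^]\<^bsub>braid_group n\<^esub> j = twist n [^]\<^bsub>braid_group n\<^esub> s"
    using xc inv_equality[of "x [^]\<^bsub>braid_group n\<^esub> j" ?t] by (simp add: int_pow_neg)
  then have "x [^]\<^bsub>braid_group n\<^esub> j \<in> group_center (braid_group n)"
    by (simp add: group_center_def twist_int_pow_central)
  then show ?thesis using j by blast
qed

end

section \<open>Homomorphisms out of the braid group\<close>

text \<open>Multiples of \<open>N\<close> in the exponent contribute central factors, so only the
  residue of \<open>j\<close> matters for conjugation.\<close>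

lemma (in group) pow_mod_shift:
  fixes N j :: nat
  assumes a: "a \<in> carrier G" and g: "g \<in> carrier G" "h \<in> carrier G"
    and c: "a [^] N \<in> group_center G"
    and r: "a [^] (j mod N) \<otimes> g = h \<otimes> a [^] (j mod N)"
  shows "a [^] j \<otimes> g = h \<otimes> a [^] j"
proof -
  have comm: "a [^] (N * q) \<otimes> h = h \<otimes> a [^] (N * q)" for q
    using group_commutes_pow[of "a [^] N" h q] c g a
    by (auto simp: group_center_def nat_pow_pow)
  have j: "a [^] j = a [^] (N * (j div N)) \<otimes> a [^] (j mod N)"
    using a by (simp add: nat_pow_mult)
  have "a [^] j \<otimes> g = a [^] (N * (j div N)) \<otimes> h \<otimes> a [^] (j mod N)"
    unfolding j using a g r by (simp add: m_assoc)
  also have "\<dots> = h \<otimes> a [^] j"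
    unfolding j comm using a g by (simp add: m_assoc)
  finally show ?thesis .
qed

text \<open>Modulo the center, the power with exponent \<open>N - 1\<close> is the inverse of
  \<open>a\<close>, so it undoes the shift by \<open>a\<close>.\<close>

lemma (in group) pow_pred_shift:
  fixes N :: nat
  assumes a: "a \<in> carrier G" and g: "g \<in> carrier G" "h \<in> carrier G" and N: "0 < N"
    and c: "a [^] N \<in> group_center G" and r: "a \<otimes> g = h \<otimes> a"
  shows "a [^] (N - 1) \<otimes> h = g \<otimes> a [^] (N - 1)"
proof -
  have N': "a [^] N = a \<otimes> a [^] (N - 1)" using a N nat_pow_Suc2[of a "N - 1"] by simp
  have "a \<otimes> (a [^] (N - 1) \<otimes> h) = a [^] N \<otimes> h" using a g by (simp add: N' m_assoc)
  also have "\<dots> = h \<otimes> a [^] N" using c g by (simp add: group_center_def)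
  also have "\<dots> = (a \<otimes> g) \<otimes> a [^] (N - 1)" using a g by (simp add: N' r m_assoc)
  also have "\<dots> = a \<otimes> (g \<otimes> a [^] (N - 1))" using a g by (simp add: m_assoc)
  finally show ?thesis using a g by simp
qed

section \<open>Two roots of the full twist and their conjugation action\<close>

definition rotation_braid :: "nat \<Rightarrow> braid_word set" where
  "rotation_braid n = pos_braid n (rotation n)"

text \<open>The braid \<open>\<beta>\<close> of the overview: its permutation fixes the first
  position and cycles the other \<open>n - 1\<close>.\<close>

definition rotation_braid' :: "nat \<Rightarrow> braid_word set" where
  "rotation_braid' n = gen n 1 \<otimes>\<^bsub>braid_group n\<^esub> rotation_braid n"

context
  fixes n :: nat
begin

interpretation group "braid_group n"
  by (rule group_braid_group)

lemma rotation_braid_closed [simp]: "rotation_braid n \<in> carrier (braid_group n)"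
  by (simp add: rotation_braid_def)

lemma rotation_braid_pow:
  "rotation_braid n [^]\<^bsub>braid_group n\<^esub> k = pos_braid n (word_power k (rotation n))"
proof (induction k)
  case (Suc k)
  then show ?case
    using set_word_power[of k "rotation n"]
    by (simp only: nat_pow_Suc2 rotation_braid_closed) (simp add: rotation_braid_def pos_braid_mult)
qed (simp add: pos_braid_Nil)

lemma rotation_braid_twist: "rotation_braid n [^]\<^bsub>braid_group n\<^esub> n = twist n"
  by (simp add: rotation_braid_pow twist_def full_twist_def)

lemma twist_in_center: "twist n \<in> group_center (braid_group n)"
  by (simp add: group_center_def twist_central)

lemma rotation_braid_pow_shift:
  assumes "1 \<le> i" "i + k < n"
  shows "rotation_braid n [^]\<^bsub>braid_group n\<^esub> k \<otimes>\<^bsub>braid_group n\<^esub> gen n i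
    = gen n (i + k) \<otimes>\<^bsub>braid_group n\<^esub> rotation_braid n [^]\<^bsub>braid_group n\<^esub> k"
  using assms rotation_power_shift[of i k n "[]"] set_word_power[of k "rotation n"]
  by (simp add: rotation_braid_pow gen_def pos_braid_mult pos_braid_eq_iff)

lemma rotation_braid_shift:
  assumes "1 \<le> i" "i + 1 < n"
  shows "rotation_braid n \<otimes>\<^bsub>braid_group n\<^esub> gen n i = gen n (i + 1) \<otimes>\<^bsub>braid_group n\<^esub> rotation_braid n"
  using rotation_braid_pow_shift[of i 1] assms by simp

lemma rotation_braid'_closed: "2 \<le> n \<Longrightarrow> rotation_braid' n \<in> carrier (braid_group n)"
  by (simp add: rotation_braid'_def)

text \<open>Each new factor \<open>\<sigma>\<^sub>1\<close> moves left past \<open>k\<close>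
  rotations, becomes the generator with index \<open>Suc k\<close>, and extends the prefix. At
  \<open>k = n - 1\<close> the prefix is itself a full rotation.\<close>

lemma rotation_braid'_pow:
  assumes "2 \<le> n" "k < n"
  shows "rotation_braid' n [^]\<^bsub>braid_group n\<^esub> k
    = pos_braid n [1..<Suc k] \<otimes>\<^bsub>braid_group n\<^esub> rotation_braid n [^]\<^bsub>braid_group n\<^esub> k"
  using assms(2)
proof (induction k)
  case 0
  then show ?case by (simp add: pos_braid_Nil)
next
  case (Suc k)
  let ?a = "rotation_braid n"
  have p: "pos_braid n [1..<Suc k] \<in> carrier (braid_group n)" using Suc by (intro pos_braid_closed) auto
  have g: "gen n 1 \<in> carrier (braid_group n)" "gen n (Suc k) \<in> carrier (braid_group n)"
    using Suc by auto
  have "rotation_braid' n [^]\<^bsub>braid_group n\<^esub> Suc k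
      = pos_braid n [1..<Suc k] \<otimes>\<^bsub>braid_group n\<^esub>
        (?a [^]\<^bsub>braid_group n\<^esub> k \<otimes>\<^bsub>braid_group n\<^esub> gen n 1) \<otimes>\<^bsub>braid_group n\<^esub> ?a"
    using Suc p g by (simp add: rotation_braid'_def m_assoc)
  also have "?a [^]\<^bsub>braid_group n\<^esub> k \<otimes>\<^bsub>braid_group n\<^esub> gen n 1
      = gen n (Suc k) \<otimes>\<^bsub>braid_group n\<^esub> ?a [^]\<^bsub>braid_group n\<^esub> k"
    using rotation_braid_pow_shift[of 1 k] Suc.prems by simp
  also have "pos_braid n [1..<Suc k] \<otimes>\<^bsub>braid_group n\<^esub>
        (gen n (Suc k) \<otimes>\<^bsub>braid_group n\<^esub> ?a [^]\<^bsub>braid_group n\<^esub> k) \<otimes>\<^bsub>braid_group n\<^esub> ?a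
      = (pos_braid n [1..<Suc k] \<otimes>\<^bsub>braid_group n\<^esub> gen n (Suc k)) \<otimes>\<^bsub>braid_group n\<^esub>
          ?a [^]\<^bsub>braid_group n\<^esub> Suc k"
    using p g by (simp add: m_assoc)
  also have "pos_braid n [1..<Suc k] \<otimes>\<^bsub>braid_group n\<^esub> gen n (Suc k) = pos_braid n [1..<Suc (Suc k)]"
  proof -
    have "[1..<Suc (Suc k)] = [1..<Suc k] @ [Suc k]" by simp
    then show ?thesis
      using Suc.prems pos_braid_mult[of "[1..<Suc k]" n "[Suc k]"]
      by (simp only: gen_def) (simp add: subset_iff del: upt_Suc)
  qed
  finally show ?case .
qed

lemma rotation_braid'_twist:
  assumes "2 \<le> n"
  shows "rotation_braid' n [^]\<^bsub>braid_group n\<^esub> (n - 1) = twist n"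
proof -
  have "rotation_braid' n [^]\<^bsub>braid_group n\<^esub> (n - 1)
      = rotation_braid n \<otimes>\<^bsub>braid_group n\<^esub> rotation_braid n [^]\<^bsub>braid_group n\<^esub> (n - 1)"
    using rotation_braid'_pow[of "n - 1"] assms
    by (simp add: rotation_braid_def[of n] rotation_def[of n] del: upt_Suc)
  also have "\<dots> = rotation_braid n [^]\<^bsub>braid_group n\<^esub> n"
    using assms nat_pow_Suc2[of "rotation_braid n" "n - 1"] by simp
  finally show ?thesis by (simp add: rotation_braid_twist)
qed

lemma gen_far_commute:
  assumes "i \<in> {1..<n}" "j \<in> {1..<n}" "far i j"
  shows "gen n i \<otimes>\<^bsub>braid_group n\<^esub> gen n j = gen n j \<otimes>\<^bsub>braid_group n\<^esub> gen n i"
  using assms pos_cong_far[of i j "[]"] by (simp add: gen_def pos_braid_mult pos_braid_eq_iff)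

lemma gen_braid_relation:
  assumes "1 \<le> i" "i + 1 < n"
  shows "gen n i \<otimes>\<^bsub>braid_group n\<^esub> gen n (i + 1) \<otimes>\<^bsub>braid_group n\<^esub> gen n i
    = gen n (i + 1) \<otimes>\<^bsub>braid_group n\<^esub> gen n i \<otimes>\<^bsub>braid_group n\<^esub> gen n (i + 1)"
  using assms pos_cong_adj[of i "i + 1" "[]"]
  by (simp add: gen_def pos_braid_mult pos_braid_eq_iff adj_def)

text \<open>The extra factor \<open>\<sigma>\<^sub>1\<close> commutes with the generator of index
  \<open>i + 1\<close>, which is at least 3; this is why the shift starts at
  \<open>i = 2\<close>.\<close>

lemma rotation_braid'_shift:
  assumes "2 \<le> i" "i + 1 < n"
  shows "rotation_braid' n \<otimes>\<^bsub>braid_group n\<^esub> gen n i = gen n (i + 1) \<otimes>\<^bsub>braid_group n\<^esub> rotation_braid' n"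
proof -
  have g: "gen n 1 \<in> carrier (braid_group n)" "gen n i \<in> carrier (braid_group n)"
      "gen n (i + 1) \<in> carrier (braid_group n)"
    using assms by auto
  have "rotation_braid' n \<otimes>\<^bsub>braid_group n\<^esub> gen n i
      = gen n 1 \<otimes>\<^bsub>braid_group n\<^esub> gen n (i + 1) \<otimes>\<^bsub>braid_group n\<^esub> rotation_braid n"
    using g rotation_braid_shift[of i] assms by (simp add: rotation_braid'_def m_assoc)
  also have "gen n 1 \<otimes>\<^bsub>braid_group n\<^esub> gen n (i + 1) = gen n (i + 1) \<otimes>\<^bsub>braid_group n\<^esub> gen n 1"
    using assms by (intro gen_far_commute) (auto simp: far_def)
  finally show ?thesis using g by (simp add: rotation_braid'_def m_assoc)
qed

lemma rotation_braid'_pow_shift: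
  assumes "2 \<le> i" "i + k < n"
  shows "rotation_braid' n [^]\<^bsub>braid_group n\<^esub> k \<otimes>\<^bsub>braid_group n\<^esub> gen n i
    = gen n (i + k) \<otimes>\<^bsub>braid_group n\<^esub> rotation_braid' n [^]\<^bsub>braid_group n\<^esub> k"
  using assms(2)
proof (induction k)
  case 0
  then show ?case using assms by simp
next
  case (Suc k)
  let ?b = "rotation_braid' n"
  have b: "?b \<in> carrier (braid_group n)" using assms by (intro rotation_braid'_closed) auto
  have g: "gen n i \<in> carrier (braid_group n)" "gen n (i + k) \<in> carrier (braid_group n)"
      "gen n (i + k + 1) \<in> carrier (braid_group n)"
    using assms Suc.prems by auto
  have "?b [^]\<^bsub>braid_group n\<^esub> Suc k \<otimes>\<^bsub>braid_group n\<^esub> gen n i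
      = ?b \<otimes>\<^bsub>braid_group n\<^esub> (?b [^]\<^bsub>braid_group n\<^esub> k \<otimes>\<^bsub>braid_group n\<^esub> gen n i)"
    using b g by (simp only: nat_pow_Suc2) (simp add: m_assoc)
  also have "\<dots> = ?b \<otimes>\<^bsub>braid_group n\<^esub> gen n (i + k) \<otimes>\<^bsub>braid_group n\<^esub> ?b [^]\<^bsub>braid_group n\<^esub> k"
    using Suc b g by (simp add: m_assoc)
  also have "\<dots> = gen n (i + k + 1) \<otimes>\<^bsub>braid_group n\<^esub> ?b \<otimes>\<^bsub>braid_group n\<^esub> ?b [^]\<^bsub>braid_group n\<^esub> k"
    using rotation_braid'_shift[of "i + k"] assms Suc.prems by simp
  also have "\<dots> = gen n (i + Suc k) \<otimes>\<^bsub>braid_group n\<^esub> ?b [^]\<^bsub>braid_group n\<^esub> Suc k"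
    using b g by (simp only: nat_pow_Suc2) (simp add: m_assoc)
  finally show ?case .
qed

lemma rotation_braids_periodic:
  assumes "2 \<le> n"
  shows "periodic_braid n (rotation_braid n)" "periodic_braid n (rotation_braid' n)"
proof -
  show "periodic_braid n (rotation_braid n)"
    unfolding periodic_braid_def
    using assms twist_in_center rotation_braid_twist rotation_braid_closed
    by (intro conjI exI[of _ n]) simp_all
  show "periodic_braid n (rotation_braid' n)"
    unfolding periodic_braid_def
    using assms twist_in_center rotation_braid'_twist rotation_braid'_closed
    by (intro conjI exI[of _ "n - 1"]) simp_all
qed

end

section \<open>Coincidences among the images of the generators\<close>

lemma (in group) braided_commuting_eq:
  assumes "a \<in> carrier G" "b \<in> carrier G" "a \<otimes> b \<otimes> a = b \<otimes> a \<otimes> b" "a \<otimes> b = b \<otimes> a"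
  shows "a = b"
proof -
  have "(a \<otimes> b) \<otimes> a = (a \<otimes> b) \<otimes> b" using assms(3,4) by simp
  then show ?thesis using assms(1,2) by simp
qed

locale braid_hom = group_hom "braid_group n" H f
  for n and H (structure) and f +
  assumes five_le: "5 \<le> n"
begin

abbreviation s :: "nat \<Rightarrow> 'a" where
  "s i \<equiv> f (gen n i)"

lemma s_closed: "i \<in> {1..<n} \<Longrightarrow> s i \<in> carrier H"
  by simp

lemma s_far: "i \<in> {1..<n} \<Longrightarrow> j \<in> {1..<n} \<Longrightarrow> far i j \<Longrightarrow> s i \<otimes> s j = s j \<otimes> s i"
  using gen_far_commute[of i n j] by (metis gen_closed hom_mult)

lemma s_braid:
  assumes "1 \<le> i" "i + 1 < n"
  shows "s i \<otimes> s (i + 1) \<otimes> s i = s (i + 1) \<otimes> s i \<otimes> s (i + 1)"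
proof -
  have "gen n i \<in> carrier (braid_group n)" "gen n (i + 1) \<in> carrier (braid_group n)"
    using assms by auto
  then show ?thesis using arg_cong[OF gen_braid_relation[OF assms], of f] by simp
qed

lemma s_eq_if_commute:
  assumes "1 \<le> i" "i + 1 < n" "s i \<otimes> s (i + 1) = s (i + 1) \<otimes> s i"
  shows "s i = s (i + 1)"
  using H.braided_commuting_eq[OF _ _ s_braid[OF assms(1,2)] assms(3)] assms(1,2) s_closed by simp

text \<open>Conjugation by the image of the rotation carries one neighbouring pair to the next.
  Hence a single coincidence spreads to all generators.\<close>

lemma s_eq_step:
  assumes "1 \<le> i" "i + 2 < n"
  shows "s i = s (i + 1) \<longleftrightarrow> s (i + 1) = s (i + 2)"
proof -
  let ?a = "f (rotation_braid n)"
  have g: "gen n i \<in> carrier (braid_group n)" "gen n (i + 1) \<in> carrier (braid_group n)"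
      "gen n (i + 2) \<in> carrier (braid_group n)"
    using assms by auto
  have conj: "?a \<otimes> s i = s (i + 1) \<otimes> ?a" "?a \<otimes> s (i + 1) = s (i + 2) \<otimes> ?a"
    using arg_cong[OF rotation_braid_shift[of i n], of f]
      arg_cong[OF rotation_braid_shift[of "i + 1" n], of f] assms g by simp_all
  have cl: "?a \<in> carrier H" "s i \<in> carrier H" "s (i + 1) \<in> carrier H" "s (i + 2) \<in> carrier H"
    using g by simp_all
  have "s i = s (i + 1) \<longleftrightarrow> ?a \<otimes> s i = ?a \<otimes> s (i + 1)" using cl by simp
  also have "\<dots> \<longleftrightarrow> s (i + 1) \<otimes> ?a = s (i + 2) \<otimes> ?a" by (simp only: conj)
  also have "\<dots> \<longleftrightarrow> s (i + 1) = s (i + 2)" using cl by (intro H.right_cancel)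
  finally show ?thesis .
qed

lemma s_all_eq:
  assumes i: "1 \<le> i" "i + 1 < n" "s i = s (i + 1)" and j: "j \<in> {1..<n}"
  shows "s j = s 1"
proof -
  have "s k = s (k + 1)" if "k \<le> i" "1 \<le> k" for k
    using that
  proof (induction k rule: inc_induct)
    case base
    then show ?case using i by simp
  next
    case (step k)
    then show ?case using s_eq_step[of k] i(2) by simp
  qed
  from this[of 1] have one: "s 1 = s (1 + 1)" using i(1) by simp
  have succ: "s k = s (k + 1)" if "1 \<le> k" "k + 1 < n" for k
    using that
  proof (induction k rule: dec_induct)
    case (step k)
    then show ?case using s_eq_step[of k] by simp
  qed (use one in simp)
  have "1 \<le> j" using j by simp
  then show ?thesis using j
  proof (induction j rule: dec_induct)
    case (step k)
    then show ?case using succ[of k] by simp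
  qed simp
qed

lemma cyclic_image:
  assumes eq: "\<And>j. j \<in> {1..<n} \<Longrightarrow> s j = s 1"
  shows "cyclic_group (H\<lparr>carrier := f ` carrier (braid_group n)\<rparr>)"
proof -
  let ?I = "f ` carrier (braid_group n)" and ?c = "s 1"
  have sub: "subgroup ?I H" by (rule img_is_subgroup)
  then have I: "group (H\<lparr>carrier := ?I\<rparr>)" by (rule subgroup.subgroup_is_group) (rule H.is_group)
  have g: "gen n 1 \<in> carrier (braid_group n)" using five_le by (intro gen_closed) auto
  have "?c [^]\<^bsub>H\<lparr>carrier := ?I\<rparr>\<^esub> e = ?c [^] e" for e :: int
    using H.int_pow_consistent[OF sub, of ?c e] g by simp
  then have pow: "range (\<lambda>e::int. ?c [^] e) = range (\<lambda>e::int. ?c [^]\<^bsub>H\<lparr>carrier := ?I\<rparr>\<^esub> e)" by simp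
  have "f x \<in> range (\<lambda>e::int. ?c [^] e)" if "x \<in> carrier (braid_group n)" for x
  proof -
    have "\<exists>e::int. f x = ?c [^] e"
      using that
    proof (induction rule: braid_induct)
      case one
      then show ?case by (intro exI[of _ 0]) simp
    next
      case (gen i x)
      then obtain e :: int where "f x = ?c [^] e" by blast
      then have "f (gen n i \<otimes>\<^bsub>braid_group n\<^esub> x) = ?c [^] (1 + e)"
        using gen g eq[of i] H.int_pow_mult[of ?c 1 e] by simp
      then show ?case by blast
    next
      case (inv_gen i x)
      then obtain e :: int where "f x = ?c [^] e" by blast
      then have "f (inv\<^bsub>braid_group n\<^esub> gen n i \<otimes>\<^bsub>braid_group n\<^esub> x) = ?c [^] (- 1 + e)"
        using inv_gen g eq[of i] H.int_pow_mult[of ?c "- 1" e] H.int_pow_neg[of ?c 1]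
        by simp
      then show ?case by blast
    qed
    then show ?thesis by blast
  qed
  moreover have "?c [^] e \<in> ?I" for e :: int
  proof -
    have "?c [^] e = f (gen n 1 [^]\<^bsub>braid_group n\<^esub> e)" using g by (simp add: hom_int_pow)
    then show ?thesis using g by blast
  qed
  ultimately have "?I = range (\<lambda>e::int. ?c [^] e)" by blast
  then have "carrier (H\<lparr>carrier := ?I\<rparr>) = range (\<lambda>e::int. ?c [^] e)" by simp
  from this pow have eq: "carrier (H\<lparr>carrier := ?I\<rparr>) =
      range (\<lambda>e::int. ?c [^]\<^bsub>H\<lparr>carrier := ?I\<rparr>\<^esub> e)"
    by (rule HOL.trans)
  have "?c \<in> carrier (H\<lparr>carrier := ?I\<rparr>)" using g by simp
  with eq show ?thesis unfolding group.cyclic_group[OF I] by (rule bexI)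
qed

lemma s_eq_if_shift:
  assumes y: "y \<in> carrier (braid_group n)" "\<And>x. x \<in> carrier H \<Longrightarrow> f y \<otimes> x = x \<otimes> f y"
    and ij: "i \<in> {1..<n}" "j \<in> {1..<n}"
    and "y \<otimes>\<^bsub>braid_group n\<^esub> gen n i = gen n j \<otimes>\<^bsub>braid_group n\<^esub> y"
  shows "s i = s j"
proof -
  have "f y \<otimes> s i = s j \<otimes> f y"
    using arg_cong[OF assms(5), of f] y(1) ij by simp
  then have "f y \<otimes> s i = f y \<otimes> s j" using y(2)[of "s j"] s_closed ij by simp
  then show ?thesis using y(1) ij s_closed by simp
qed

text \<open>In the image, conjugation by the rotation to the power \<open>?r\<close> is trivial, so
  generators \<open>?r\<close> apart coincide. Residues 1 and \<open>n - 1\<close> identify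
  neighbours directly; any other residue makes \<open>s 1\<close> or \<open>s 2\<close> equal to a
  generator that commutes with the other one.\<close>

lemma cyclic_image_if_rotation_pow_central:
  assumes c: "f (rotation_braid n) [^] j \<in> group_center H" and j: "\<not> n dvd j"
  shows "cyclic_group (H\<lparr>carrier := f ` carrier (braid_group n)\<rparr>)"
proof -
  let ?a = "rotation_braid n" and ?r = "j mod n"
  have r: "0 < ?r" "?r < n" using j five_le by (auto simp: mod_greater_zero_iff_not_dvd)
  have a: "?a \<in> carrier (braid_group n)" by (rule rotation_braid_closed)
  have ac: "f (?a [^]\<^bsub>braid_group n\<^esub> j) \<otimes> x = x \<otimes> f (?a [^]\<^bsub>braid_group n\<^esub> j)"
    if "x \<in> carrier H" for x
    using c that a by (simp add: hom_nat_pow group_center_def)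
  have center: "?a [^]\<^bsub>braid_group n\<^esub> n \<in> group_center (braid_group n)"
    by (simp add: rotation_braid_twist twist_in_center)
  have mod_eq: "s i = s k" if "i \<in> {1..<n}" "k \<in> {1..<n}"
    "?a [^]\<^bsub>braid_group n\<^esub> ?r \<otimes>\<^bsub>braid_group n\<^esub> gen n i = gen n k \<otimes>\<^bsub>braid_group n\<^esub> ?a [^]\<^bsub>braid_group n\<^esub> ?r"
    for i k
    using s_eq_if_shift[OF _ ac that(1,2) G.pow_mod_shift[OF a _ _ center that(3)]] that a
    by simp
  have shift: "s i = s (i + ?r)" if "1 \<le> i" "i + ?r < n" for i
    using that by (intro mod_eq rotation_braid_pow_shift) auto
  consider "?r = 1" | "2 \<le> ?r" "?r + 2 < n" | "?r = n - 2" | "?r = n - 1" using r by linarith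
  then have "s 1 = s (1 + 1)"
  proof cases
    case 1
    then show ?thesis using shift[of 1] five_le by simp
  next
    case 2
    then have "s 2 = s (2 + ?r)" using shift by simp
    then have "s 1 \<otimes> s (1 + 1) = s (1 + 1) \<otimes> s 1"
      using s_far[of 1 "2 + ?r"] 2 five_le by (simp add: far_def numeral_2_eq_2)
    then show ?thesis using s_eq_if_commute five_le by simp
  next
    case 3
    then have "1 + ?r = n - 1" using five_le by simp
    then have "s 1 = s (n - 1)" using shift[of 1] five_le by simp
    \<comment> \<open>Indices 2 and \<open>n - 1\<close> are far apart precisely because
      \<open>n\<close> is at least 5.\<close>
    then have "s 1 \<otimes> s (1 + 1) = s (1 + 1) \<otimes> s 1"
      using s_far[of "n - 1" 2] five_le by (simp add: far_def numeral_2_eq_2)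
    then show ?thesis using s_eq_if_commute five_le by simp
  next
    case 4
    have "?a [^]\<^bsub>braid_group n\<^esub> (n - 1) \<otimes>\<^bsub>braid_group n\<^esub> gen n (1 + 1)
        = gen n 1 \<otimes>\<^bsub>braid_group n\<^esub> ?a [^]\<^bsub>braid_group n\<^esub> (n - 1)"
      using five_le center a by (intro G.pow_pred_shift rotation_braid_shift gen_closed) auto
    then have "s (1 + 1) = s 1" using five_le 4 by (intro mod_eq) auto
    then show ?thesis by simp
  qed
  with five_le have "s i = s 1" if "i \<in> {1..<n}" for i
    using that by (intro s_all_eq[of 1]) simp_all
  then show ?thesis by (rule cyclic_image)
qed

text \<open>The same argument with shifts starting only at index 2: the extreme residues 1 and
  \<open>n - 2\<close> identify \<open>s 2\<close> with \<open>s 3\<close>, and the residues between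
  them make \<open>s 1\<close> and \<open>s 2\<close> commute.\<close>

lemma cyclic_image_if_rotation'_pow_central:
  assumes c: "f (rotation_braid' n) [^] j \<in> group_center H" and j: "\<not> (n - 1) dvd j"
  shows "cyclic_group (H\<lparr>carrier := f ` carrier (braid_group n)\<rparr>)"
proof -
  let ?b = "rotation_braid' n" and ?r = "j mod (n - 1)"
  have r: "0 < ?r" "?r < n - 1" using j five_le by (auto simp: mod_greater_zero_iff_not_dvd)
  have b: "?b \<in> carrier (braid_group n)" using five_le by (intro rotation_braid'_closed) auto
  have bc: "f (?b [^]\<^bsub>braid_group n\<^esub> j) \<otimes> x = x \<otimes> f (?b [^]\<^bsub>braid_group n\<^esub> j)"
    if "x \<in> carrier H" for x
    using c that b by (simp add: hom_nat_pow group_center_def)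
  have center: "?b [^]\<^bsub>braid_group n\<^esub> (n - 1) \<in> group_center (braid_group n)"
    using five_le rotation_braid'_twist[of n] twist_in_center by simp
  have mod_eq: "s i = s k" if "i \<in> {1..<n}" "k \<in> {1..<n}"
    "?b [^]\<^bsub>braid_group n\<^esub> ?r \<otimes>\<^bsub>braid_group n\<^esub> gen n i = gen n k \<otimes>\<^bsub>braid_group n\<^esub> ?b [^]\<^bsub>braid_group n\<^esub> ?r"
    for i k
    using s_eq_if_shift[OF _ bc that(1,2) G.pow_mod_shift[OF b _ _ center that(3)]] that b
    by simp
  have shift: "s i = s (i + ?r)" if "2 \<le> i" "i + ?r < n" for i
    using that by (intro mod_eq rotation_braid'_pow_shift) auto
  consider "?r = 1" | "2 \<le> ?r" "?r + 2 < n" | "?r = n - 1 - 1" using r by linarith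
  then have "\<exists>i. 1 \<le> i \<and> i + 1 < n \<and> s i = s (i + 1)"
  proof cases
    case 1
    then show ?thesis using shift[of 2] five_le by (intro exI[of _ 2]) simp
  next
    case 2
    then have "s 2 = s (2 + ?r)" using shift by simp
    then have "s 1 \<otimes> s (1 + 1) = s (1 + 1) \<otimes> s 1"
      using s_far[of 1 "2 + ?r"] 2 five_le by (simp add: far_def numeral_2_eq_2)
    then show ?thesis using s_eq_if_commute[of 1] five_le by (intro exI[of _ 1]) simp
  next
    case 3
    have "?b [^]\<^bsub>braid_group n\<^esub> (n - 1 - 1) \<otimes>\<^bsub>braid_group n\<^esub> gen n (2 + 1)
        = gen n 2 \<otimes>\<^bsub>braid_group n\<^esub> ?b [^]\<^bsub>braid_group n\<^esub> (n - 1 - 1)"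
      using five_le center b by (intro G.pow_pred_shift rotation_braid'_shift gen_closed) auto
    then have "s (2 + 1) = s 2" using five_le 3 by (intro mod_eq) auto
    then show ?thesis using five_le by (intro exI[of _ 2]) simp
  qed
  then obtain i where "1 \<le> i" "i + 1 < n" "s i = s (i + 1)" by blast
  then have "s k = s 1" if "k \<in> {1..<n}" for k using that by (rule s_all_eq)
  then show ?thesis by (rule cyclic_image)
qed

end

theorem theorem1p4:
  fixes n m :: nat and f :: "braid_word set \<Rightarrow> braid_word set"
  assumes "n \<ge> 5" and "m \<ge> 1"
    and "\<exists>d\<in>{n, n - 1}. \<not> d dvd m \<and> \<not> d dvd (m - 1)"
    and "special_hom n m f"
  shows "cyclic_group ((braid_group m)\<lparr>carrier := f ` carrier (braid_group n)\<rparr>)"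
proof -
  have hom: "f \<in> hom (braid_group n) (braid_group m)"
    and special: "\<And>x. periodic_braid n x \<Longrightarrow> periodic_braid m (f x)"
    using assms(4) by (auto simp: special_hom_def periodic_braid_def)
  interpret braid_hom n "braid_group m" f
    using hom assms(1)
    by (intro braid_hom.intro group_hom.intro group_hom_axioms.intro braid_hom_axioms.intro
        group_braid_group)
  obtain d where d: "d \<in> {n, n - 1}" "\<not> d dvd m" "\<not> d dvd (m - 1)" using assms(3) by blast
  \<comment> \<open>For \<open>m = 1\<close> the number \<open>m - 1\<close> would be 0, which every
    \<open>d\<close> divides.\<close>
  have m: "2 \<le> m" using d(3) assms(2) by (cases "m = 1") auto
  \<comment> \<open>A \<open>d\<close>-th root of the full twist, so that conjugation by its powers
    depends only on the exponent modulo \<open>d\<close>.\<close>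
  define x where "x = (if d = n then rotation_braid n else rotation_braid' n)"
  have "periodic_braid m (f x)"
    using special rotation_braids_periodic[of n] assms(1) by (simp add: x_def)
  then obtain j where j: "j \<in> {m, m - 1}" "f x [^]\<^bsub>braid_group m\<^esub> j \<in> group_center (braid_group m)"
    using periodic_power_central[OF _ m] by blast
  have "\<not> d dvd j" using j(1) d by auto
  then show ?thesis
    using cyclic_image_if_rotation_pow_central[of j] cyclic_image_if_rotation'_pow_central[of j] j(2) d(1)
    by (auto simp: x_def split: if_splits)
qed

end
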